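(* Let $\mathcal{R}=\{(\xi(C),\psi(C)) : C\in\mathcal{C}\}\subseteq[0,1]\times[-\frac12,1]$. Then $\mathcal{R}$ is convex and closed. Moreover, every $(x,y)\in\mathcal{R}$ satisfies $y\le\sqrt{x}$, and if in addition $y\le 0$, then $x\ge \Xi(\mu(y))$, where $\mu(y)$ is the unique solution in $[0,2]$ of the cubic equation $\mu^3-(4+2y)\mu^2-(4+8y)\mu-8y=0$ and, with $v_1=\frac{2}{2+\mu}$, \[ \Xi(\mu)=-4v_1^2+20v_1-17+\frac{2}{v_1}-\frac{1}{v_1^2}-12\ln(v_1). \]
   Context: $\mathcal{C}$ is the set of bivariate copulas; $\xi(C)=6\int_0^1\int_0^1(\partial_1C(u,v))^2\,du\,dv-2$, $\psi(C)=6\int_0^1C(u,u)\,du-2$. (Here $\Xi(\mu)=\xi(C^{\searrow}_\mu)$ for the explicit function family of the lower boundary estimate; $\mu(y)$ is characterized by $-2v_1^2+6v_1-5+1/v_1=y$ with $v_1=2/(2+\mu(y))$.) *)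

theory Defs
  imports "HOL-Analysis.Analysis"
begin

text \<open>Bivariate copulas, as functions on the unit square (values outside are irrelevant).\<close>
definition is_copula :: "(real \<Rightarrow> real \<Rightarrow> real) \<Rightarrow> bool" where
  "is_copula C \<longleftrightarrow>
     (\<forall>u\<in>{0..1}. C u 0 = 0 \<and> C 0 u = 0 \<and> C u 1 = u \<and> C 1 u = u) \<and>
     (\<forall>u1 u2 v1 v2. 0 \<le> u1 \<and> u1 \<le> u2 \<and> u2 \<le> 1 \<and> 0 \<le> v1 \<and> v1 \<le> v2 \<and> v2 \<le> 1 \<longrightarrow>
        C u2 v2 - C u2 v1 - C u1 v2 + C u1 v1 \<ge> 0)"

text \<open>Partial derivative in the first argument (set to 0 where it does not exist;
  it exists almost everywhere for a copula).\<close>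
definition d1 :: "(real \<Rightarrow> real \<Rightarrow> real) \<Rightarrow> real \<Rightarrow> real \<Rightarrow> real" where
  "d1 C u v = (if \<exists>d. ((\<lambda>t. C t v) has_real_derivative d) (at u)
               then (SOME d. ((\<lambda>t. C t v) has_real_derivative d) (at u)) else 0)"

definition xi :: "(real \<Rightarrow> real \<Rightarrow> real) \<Rightarrow> real" where
  "xi C = 6 * integral (cbox (0,0) (1,1)) (\<lambda>(u,v). (d1 C u v)\<^sup>2) - 2"

definition psi :: "(real \<Rightarrow> real \<Rightarrow> real) \<Rightarrow> real" where
  "psi C = 6 * integral {0..1} (\<lambda>u. C u u) - 2"

definition region :: "(real \<times> real) set" where
  "region = {(xi C, psi C) | C. is_copula C}"

definition mu_cubic :: "real \<Rightarrow> real \<Rightarrow> real" where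
  "mu_cubic y m = m^3 - (4 + 2*y) * m^2 - (4 + 8*y) * m - 8*y"

definition mu :: "real \<Rightarrow> real" where
  "mu y = (THE m. m \<in> {0..2} \<and> mu_cubic y m = 0)"

definition Xi :: "real \<Rightarrow> real" where
  "Xi m = (let v1 = 2 / (2 + m) in
     - 4 * v1^2 + 20 * v1 - 17 + 2 / v1 - 1 / v1^2 - 12 * ln v1)"

end

theory Submission
  imports Defs "HOL-Complex_Analysis.Great_Picard"
begin

text \<open>
  Write \<open>\<delta> v = C v v\<close> and \<open>w = v (1 - v)\<close>. Comparing the section \<open>u \<mapsto> \<partial>\<^sub>1 C (u, v)\<close>, which has integral
  \<open>v\<close> over \<open>[0, 1]\<close> and \<open>\<delta> v\<close> over \<open>[0, v]\<close>, with its means over \<open>[0, v]\<close> and \<open>[v, 1]\<close> gives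
  \<open>\<xi> \<ge> 6 \<integral> (\<delta> - v\<^sup>2)\<^sup>2 / w\<close>, while \<open>\<psi> = 6 \<integral> (\<delta> - v\<^sup>2)\<close>. Since \<open>\<integral> w = 1/6\<close>, Cauchy-Schwarz yields
  \<open>\<psi>\<^sup>2 \<le> \<xi>\<close>; minimising \<open>\<xi> + \<mu> \<psi>\<close> pointwise under the constraint \<open>\<delta> \<ge> max 0 (2 v - 1)\<close> yields the
  lower bound \<open>\<Xi>\<close>.

  For convexity and closedness, \<open>\<psi>\<close> is affine and continuous in \<open>C\<close>, and \<open>\<xi>\<close> is convex and lower
  semicontinuous. Every value of \<open>\<psi>\<close> is attained by a copula with \<open>\<xi> = 1\<close>, and mixing with it shows
  that the region contains, with any point \<open>(x, y)\<close>, the whole segment up to \<open>(1, y)\<close>. So it is enough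
  to reach the required \<open>y\<close> with a not too large \<open>x\<close>.
\<close>

section \<open>Differentiation of monotone Lipschitz functions\<close>

text \<open>The Lipschitz bound makes \<open>x - F x\<close> monotone, so it has a Stieltjes measure
  too. On an interval the increments of \<open>F\<close> and of \<open>x - F x\<close> add up to the
  length, and Lebesgue measure is determined by its values on open intervals.\<close>

lemma interval_measure_add_eq_lborel:
  fixes F :: "real \<Rightarrow> real"
  assumes mono: "\<And>x y. x \<le> y \<Longrightarrow> F x \<le> F y"
    and lip: "\<And>x y. x \<le> y \<Longrightarrow> F y - F x \<le> y - x"
    and cont: "continuous_on UNIV F"
    and A: "A \<in> sets borel"
  shows "emeasure (interval_measure F) A + emeasure (interval_measure (\<lambda>x. x - F x)) A
           = emeasure lborel A"
proof -
  let ?M = "interval_measure F" and ?N = "interval_measure (\<lambda>x. x - F x)"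
  \<comment> \<open>\<open>P\<close> is the sum of the two Stieltjes measures, defined setwise; it
    remains to check countable additivity.\<close>
  define P where "P = measure_of UNIV (sets borel) (\<lambda>A. emeasure ?M A + emeasure ?N A)"
  have sP: "sets P = sets borel"
    unfolding P_def by (metis sets_measure_of sets.sigma_sets_eq space_borel subset_Pow_Union
        sets.space_closed)
  have eP: "emeasure P B = emeasure ?M B + emeasure ?N B" if "B \<in> sets borel" for B
    unfolding P_def
  proof (rule emeasure_measure_of_sigma)
    show "sigma_algebra UNIV (sets (borel::real measure))"
      by (metis sets.sigma_algebra_axioms space_borel)
    show "positive (sets borel) (\<lambda>A. emeasure ?M A + emeasure ?N A)"
      by (simp add: positive_def)
    show "countably_additive (sets borel) (\<lambda>A. emeasure ?M A + emeasure ?N A)"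
    proof (rule countably_additiveI)
      fix B :: "nat \<Rightarrow> real set"
      assume B: "range B \<subseteq> sets borel" "disjoint_family B" "\<Union> (range B) \<in> sets borel"
      have "(\<Sum>i. emeasure ?M (B i) + emeasure ?N (B i))
              = (\<Sum>i. emeasure ?M (B i)) + (\<Sum>i. emeasure ?N (B i))"
        by (rule suminf_add[symmetric]) auto
      also have "(\<Sum>i. emeasure ?M (B i)) = emeasure ?M (\<Union> (range B))"
        by (rule suminf_emeasure) (use B in auto)
      also have "(\<Sum>i. emeasure ?N (B i)) = emeasure ?N (\<Union> (range B))"
        by (rule suminf_emeasure) (use B in auto)
      finally show "(\<Sum>i. emeasure ?M (B i) + emeasure ?N (B i))
          = emeasure ?M (\<Union> (range B)) + emeasure ?N (\<Union> (range B))" .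
    qed
  qed (use that in auto)
  have cN: "continuous_on UNIV (\<lambda>x. x - F x)"
    by (intro continuous_intros cont)
  have mN: "x - F x \<le> y - F y" if "x \<le> y" for x y
    using lip[OF that] by simp
  have "lborel = P"
  proof (rule lborel_eqI)
    fix l u :: real
    assume "\<And>b. b \<in> Basis \<Longrightarrow> l \<bullet> b \<le> u \<bullet> b"
    then have lu: "l \<le> u" by simp
    \<comment> \<open>Continuity rules out atoms, so the formula for half-open intervals passes to
      open ones.\<close>
    have sing: "emeasure ?M {u} = 0" "emeasure ?N {u} = 0"
      using emeasure_interval_measure_Icc[of u u F, OF _ mono cont]
        emeasure_interval_measure_Icc[of u u, OF _ mN cN] by auto
    have "emeasure ?M {l<..<u} = F u - F l"
    proof (cases "l = u")
      case False
      then have "{l<..u} = {l<..<u} \<union> {u}" using lu by auto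
      moreover have "emeasure ?M ({l<..<u} \<union> {u}) = emeasure ?M {l<..<u}"
        by (rule emeasure_Un_null_set) (use sing in auto)
      moreover have "emeasure ?M {l<..u} = F u - F l"
        using cont by (intro emeasure_interval_measure_Ioc lu mono)
           (auto simp: continuous_on_eq_continuous_within intro: continuous_within_subset)
      ultimately show ?thesis by simp
    qed auto
    moreover have "emeasure ?N {l<..<u} = (u - F u) - (l - F l)"
    proof (cases "l = u")
      case False
      then have "{l<..u} = {l<..<u} \<union> {u}" using lu by auto
      moreover have "emeasure ?N ({l<..<u} \<union> {u}) = emeasure ?N {l<..<u}"
        by (rule emeasure_Un_null_set) (use sing in auto)
      moreover have "emeasure ?N {l<..u} = (u - F u) - (l - F l)"
        using cN by (intro emeasure_interval_measure_Ioc lu mN)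
           (auto simp: continuous_on_eq_continuous_within intro: continuous_within_subset)
      ultimately show ?thesis by simp
    qed auto
    ultimately show "emeasure P (box l u) = ennreal (\<Prod>b\<in>Basis. (u - l) \<bullet> b)"
      using mono[OF lu] lip[OF lu] by (simp add: eP box_real flip: ennreal_plus)
  qed (use sP in auto)
  then show ?thesis using eP[OF A] by simp
qed

text \<open>Both \<open>F\<close> and \<open>x - F x\<close> induce Stieltjes measures, which add up to Lebesgue measure; so the
  one of \<open>F\<close> is absolutely continuous and Radon-Nikodym provides the density.\<close>
lemma mono_lipschitz_density:
  fixes F :: "real \<Rightarrow> real"
  assumes mono: "\<And>x y. x \<le> y \<Longrightarrow> F x \<le> F y"
    and lip: "\<And>x y. x \<le> y \<Longrightarrow> F y - F x \<le> y - x"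
  obtains g :: "real \<Rightarrow> real" where "\<And>a b. a \<le> b \<Longrightarrow> (g has_integral (F b - F a)) {a..b}"
proof -
  have cont: "continuous_on UNIV F"
  proof -
    have "1-lipschitz_on UNIV F"
    proof (rule lipschitz_onI)
      fix x y :: real
      show "dist (F x) (F y) \<le> 1 * dist x y"
        using mono[of x y] mono[of y x] lip[of x y] lip[of y x] by (cases "x \<le> y") (auto simp: dist_real_def)
    qed auto
    then show ?thesis by (rule lipschitz_on_continuous_on)
  qed
  let ?M = "interval_measure F"
  have ac: "absolutely_continuous lborel ?M"
    unfolding absolutely_continuous_def
  proof
    fix A :: "real set" assume "A \<in> null_sets lborel"
    then have A: "A \<in> sets borel" "emeasure lborel A = 0" by auto
    have "emeasure ?M A = 0"
      using interval_measure_add_eq_lborel[OF mono lip cont A(1)] A(2) by simp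
    then show "A \<in> null_sets ?M" using A by auto
  qed
  obtain f where f[measurable]: "f \<in> borel_measurable lborel" and df: "density lborel f = ?M"
    using sigma_finite_measure.Radon_Nikodym[OF sigma_finite_lborel ac] by auto
  define g where "g = (\<lambda>x. enn2real (f x))"
  have "(g has_integral (F b - F a)) {a..b}" if ab: "a \<le> b" for a b
  proof -
    have "(\<integral>\<^sup>+ x. f x * indicator {a..b} x \<partial>lborel) = emeasure (density lborel f) {a..b}"
      by (rule emeasure_density[symmetric]) auto
    also have "\<dots> = F b - F a"
      unfolding df by (rule emeasure_interval_measure_Icc[OF ab mono cont])
    finally have int: "(\<integral>\<^sup>+ x. f x * indicator {a..b} x \<partial>lborel) = F b - F a" .
    \<comment> \<open>The Radon-Nikodym density may take the value infinity, but only on a null set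
      because its integral over \<open>{a..b}\<close> is finite. Hence the real-valued
      \<open>g\<close> represents it.\<close>
    then have "AE x in lborel. f x * indicator {a..b} x \<noteq> \<infinity>"
      by (intro nn_integral_noteq_infinite) auto
    then have "AE x in lborel. ennreal (g x * indicator {a..b} x) = f x * indicator {a..b} x"
      by eventually_elim (auto simp: g_def indicator_def less_top)
    then have "(\<integral>\<^sup>+ x. ennreal (g x * indicator {a..b} x) \<partial>lborel) = F b - F a"
      using int by (simp cong: nn_integral_cong_AE)
    then have "((\<lambda>x. g x * indicator {a..b} x) has_integral (F b - F a)) UNIV"
      by (intro nn_integral_has_integral) (auto simp: g_def mono[OF ab])
    moreover have "(\<lambda>x. g x * indicator {a..b} x) = (\<lambda>x. if x \<in> {a..b} then g x else 0)"
      by auto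
    ultimately show ?thesis
      by (simp only: has_integral_restrict_UNIV)
  qed
  then show ?thesis by (rule that)
qed

text \<open>Lebesgue differentiation in its one-sided form controls the means over
  \<open>[x, x + h]\<close> with \<open>h > 0\<close>. Applying it also to the reflected density
  \<open>g (- x)\<close> covers \<open>h < 0\<close>; off both null sets the two one-sided limits
  agree.\<close>

lemma AE_has_derivative_of_density:
  fixes F g :: "real \<Rightarrow> real"
  assumes g: "\<And>a b. a \<le> b \<Longrightarrow> (g has_integral (F b - F a)) {a..b}"
  shows "AE x in lborel. (F has_real_derivative g x) (at x)"
proof -
  have int: "g integrable_on cbox a b" for a b
    using g[of a b] by (cases "a \<le> b") (auto simp: integrable_on_def)
  obtain N where N: "negligible N" "\<And>x e. \<lbrakk>x \<notin> N; 0 < e\<rbrakk> \<Longrightarrow>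
       \<exists>d>0. \<forall>h. 0 < h \<and> h < d \<longrightarrow>
         norm(integral (cbox x (x + h *\<^sub>R One)) g /\<^sub>R h ^ DIM(real) - g x) < e"
    using integrable_ccontinuous_explicit[OF int] by metis
  have refl: "((\<lambda>x. g (- x)) has_integral (F (-a) - F (-b))) {a..b}" if "a \<le> b" for a b
    using g[of "-b" "-a"] that has_integral_reflect_real[of g "F (-a) - F (-b)" "-a" "-b"] by simp
  have int': "(\<lambda>x. g (- x)) integrable_on cbox a b" for a b
    using refl[of a b] by (cases "a \<le> b") (auto simp: integrable_on_def)
  obtain N' where N': "negligible N'" "\<And>x e. \<lbrakk>x \<notin> N'; 0 < e\<rbrakk> \<Longrightarrow>
       \<exists>d>0. \<forall>h. 0 < h \<and> h < d \<longrightarrow>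
         norm(integral (cbox x (x + h *\<^sub>R One)) (\<lambda>x. g (- x)) /\<^sub>R h ^ DIM(real) - g (- x)) < e"
    using integrable_ccontinuous_explicit[OF int'] by metis
  have "negligible (uminus ` N')"
    by (rule negligible_differentiable_image_negligible)
       (use N' in \<open>auto intro!: derivative_intros simp: differentiable_on_def\<close>)
  then have neg: "negligible (N \<union> uminus ` N')" using N(1) by (rule negligible_Un[rotated])
  have der: "(F has_real_derivative g x) (at x)" if x: "x \<notin> N \<union> uminus ` N'" for x
    unfolding DERIV_def LIM_def
  proof (intro allI impI)
    fix e :: real assume e: "0 < e"
    from x have x1: "x \<notin> N" and x2: "- x \<notin> N'" by (auto simp: image_iff)
    obtain d where d: "d > 0" "\<And>h. 0 < h \<Longrightarrow> h < d \<Longrightarrow>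
        norm(integral (cbox x (x + h *\<^sub>R One)) g /\<^sub>R h ^ DIM(real) - g x) < e"
      using N(2)[OF x1 e] by blast
    obtain d' where d': "d' > 0" "\<And>h. 0 < h \<Longrightarrow> h < d' \<Longrightarrow>
        norm(integral (cbox (-x) (-x + h *\<^sub>R One)) (\<lambda>x. g (- x)) /\<^sub>R h ^ DIM(real) - g x) < e"
      using N'(2)[OF x2 e] by auto
    have "dist ((F (x + h) - F x) / h) (g x) < e" if h: "h \<noteq> 0" "\<bar>h\<bar> < min d d'" for h
    proof (cases "h > 0")
      case True
      then have "integral {x..x+h} g = F (x+h) - F x"
        using g[of x "x+h"] by (simp add: integral_unique)
      then show ?thesis using d(2)[of h] h True by (simp add: dist_real_def field_simps)
    next
      case False
      then have "integral {-x..-x-h} (\<lambda>x. g (-x)) = F x - F (x+h)"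
        using refl[of "-x" "-x-h"] by (simp add: integral_unique add.commute)
      then have "\<bar>(F x - F (x+h)) / (-h) - g x\<bar> < e"
        using d'(2)[of "-h"] h False by (simp add: divide_inverse mult.commute)
      moreover have "(F x - F (x+h)) / (-h) = (F (x+h) - F x) / h"
        by (simp add: minus_divide_left)
      ultimately show ?thesis by (simp add: dist_real_def)
    qed
    then show "\<exists>s>0. \<forall>h. h \<noteq> 0 \<and> dist h 0 < s \<longrightarrow> dist ((F (x + h) - F x) / h) (g x) < e"
      using d(1) d'(1) by (intro exI[of _ "min d d'"]) auto
  qed
  have "N \<union> uminus ` N' \<in> null_sets lebesgue"
    using neg negligible_iff_null_sets by blast
  then have "AE x in lebesgue. (F has_real_derivative g x) (at x)"
    by (rule AE_I') (use der in auto)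
  then show ?thesis by (simp add: AE_completion_iff)
qed

section \<open>Differentiability as a Borel condition\<close>

definition difference_quotient :: "(real \<Rightarrow> real) \<Rightarrow> real \<Rightarrow> real \<Rightarrow> real" where
  "difference_quotient F x h = (F (x + h) - F x) / h"

text \<open>Only countably many conditions occur on the right, so differentiability is a Borel condition.\<close>
lemma differentiable_iff_rational_Cauchy:
  fixes F :: "real \<Rightarrow> real"
  assumes cont: "continuous_on UNIV F"
  shows "(\<exists>d. (F has_real_derivative d) (at x)) \<longleftrightarrow>
    (\<forall>k::nat. \<exists>m::nat. \<forall>p q::rat.
        \<bar>real_of_rat p\<bar> < 1 / Suc m \<and> p \<noteq> 0 \<and> \<bar>real_of_rat q\<bar> < 1 / Suc m \<and> q \<noteq> 0 \<longrightarrow>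
        \<bar>difference_quotient F x (of_rat p) - difference_quotient F x (of_rat q)\<bar> \<le> 1 / Suc k)"
    (is "?L \<longleftrightarrow> (\<forall>k. ?R k)")
proof
  assume ?L
  then obtain d where d: "(F has_real_derivative d) (at x)" by blast
  show "\<forall>k. ?R k"
  proof
    fix k
    have "\<exists>s>0. \<forall>h. h \<noteq> 0 \<and> norm (h - 0) < s \<longrightarrow>
            norm ((F (x + h) - F x) / h - d) < 1 / (2 * real (Suc k))"
      using d[unfolded DERIV_def, unfolded LIM_eq] by simp
    then obtain s where s: "s > 0"
      "\<And>h. h \<noteq> 0 \<Longrightarrow> \<bar>h\<bar> < s \<Longrightarrow> \<bar>difference_quotient F x h - d\<bar> < 1 / (2 * real (Suc k))"
      by (auto simp: difference_quotient_def)
    obtain m where m: "1 / real (Suc m) < s" using s(1) nat_approx_posE by blast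
    show "?R k"
    proof (intro exI[of _ m] allI impI)
      fix p q :: rat
      assume *: "\<bar>real_of_rat p\<bar> < 1 / Suc m \<and> p \<noteq> 0 \<and> \<bar>real_of_rat q\<bar> < 1 / Suc m \<and> q \<noteq> 0"
      have "\<bar>difference_quotient F x (of_rat p) - d\<bar> < 1 / (2 * real (Suc k))"
           "\<bar>difference_quotient F x (of_rat q) - d\<bar> < 1 / (2 * real (Suc k))"
        using * m by (intro s(2); simp)+
      moreover have "1 / (2 * real (Suc k)) + 1 / (2 * real (Suc k)) = 1 / Suc k"
        by (simp add: field_simps)
      moreover have "\<bar>a - d\<bar> < c \<Longrightarrow> \<bar>b - d\<bar> < c \<Longrightarrow> \<bar>a - b\<bar> \<le> c + c" for a b c :: real
        by linarith
      ultimately show "\<bar>difference_quotient F x (of_rat p) - difference_quotient F x (of_rat q)\<bar>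
          \<le> 1 / Suc k"
        by metis
    qed
  qed
next
  assume R: "\<forall>k. ?R k"
  \<comment> \<open>The increments \<open>1 / Suc n\<close> are rational, so the hypothesis makes
    these quotients a Cauchy sequence; its limit is the candidate derivative.\<close>
  define a where "a = (\<lambda>n. difference_quotient F x (1 / Suc n))"
  have a_rat: "a n = difference_quotient F x (of_rat (1 / of_nat (Suc n)))" for n
    unfolding a_def by (simp add: of_rat_divide of_rat_add)
  have "Cauchy a"
  proof (rule CauchyI')
    fix e :: real assume "e > 0"
    then obtain k where k: "1 / real (Suc k) < e" using nat_approx_posE by blast
    obtain m where m: "\<And>p q::rat.
        \<bar>real_of_rat p\<bar> < 1 / Suc m \<and> p \<noteq> 0 \<and> \<bar>real_of_rat q\<bar> < 1 / Suc m \<and> q \<noteq> 0 \<Longrightarrow>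
        \<bar>difference_quotient F x (of_rat p) - difference_quotient F x (of_rat q)\<bar> \<le> 1 / Suc k"
      using R by blast
    have "dist (a i) (a j) < e" if "i > m" "j > i" for i j
    proof -
      have "\<bar>a i - a j\<bar> \<le> 1 / Suc k"
        unfolding a_rat using that
        by (intro m) (auto simp: of_rat_divide of_rat_add field_simps)
      then show ?thesis using k by (simp add: dist_real_def)
    qed
    then show "\<exists>M. \<forall>i\<ge>M. \<forall>j>i. dist (a i) (a j) < e"
      by (intro exI[of _ "Suc m"]) auto
  qed
  then obtain d where d: "a \<longlonglongrightarrow> d"
    using Cauchy_convergent convergent_def by blast
  have "(difference_quotient F x \<longlongrightarrow> d) (at 0)"
    unfolding LIM_eq
  proof (intro allI impI)
    fix e :: real assume "e > 0"
    then have "e/2 > 0" by simp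
    then obtain k where k: "1 / real (Suc k) < e/2" using nat_approx_posE by blast
    obtain m where m: "\<And>p q::rat.
        \<bar>real_of_rat p\<bar> < 1 / Suc m \<and> p \<noteq> 0 \<and> \<bar>real_of_rat q\<bar> < 1 / Suc m \<and> q \<noteq> 0 \<Longrightarrow>
        \<bar>difference_quotient F x (of_rat p) - difference_quotient F x (of_rat q)\<bar> \<le> 1 / Suc k"
      using R by blast
    \<comment> \<open>Letting the second rational increment run through \<open>1 / Suc n\<close>
      replaces its quotient by the limit \<open>d\<close>.\<close>
    have rat: "\<bar>difference_quotient F x (of_rat p) - d\<bar> \<le> 1 / Suc k"
      if p: "\<bar>real_of_rat p\<bar> < 1 / Suc m" "p \<noteq> 0" for p :: rat
    proof (rule LIMSEQ_le_const2)
      show "(\<lambda>n. \<bar>difference_quotient F x (of_rat p) - a n\<bar>)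
              \<longlonglongrightarrow> \<bar>difference_quotient F x (of_rat p) - d\<bar>"
        by (intro tendsto_intros d)
      have "\<bar>difference_quotient F x (of_rat p) - a n\<bar> \<le> 1 / Suc k" if "n > m" for n
        unfolding a_rat using that p
        by (intro m) (auto simp: of_rat_divide of_rat_add field_simps)
      then show "\<exists>N. \<forall>n\<ge>N. \<bar>difference_quotient F x (of_rat p) - a n\<bar> \<le> 1 / Suc k"
        by (intro exI[of _ "Suc m"]) auto
    qed
    have "norm (difference_quotient F x h - d) < e" if h: "h \<noteq> 0" "\<bar>h\<bar> < 1 / Suc m" for h
    proof -
      have "isCont (difference_quotient F x) h"
        unfolding difference_quotient_def using cont h(1)
        by (intro continuous_intros continuous_at_compose[of _ "\<lambda>h. x + h" F, unfolded o_def])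
           (auto simp: continuous_on_eq_continuous_at)
      then obtain s where s: "s > 0"
        "\<And>p. \<bar>p - h\<bar> < s \<Longrightarrow> \<bar>difference_quotient F x p - difference_quotient F x h\<bar> < e/2"
        using \<open>e/2 > 0\<close> unfolding continuous_at_eps_delta dist_real_def by metis
      \<comment> \<open>A real increment \<open>h\<close> is replaced by a nearby rational
        \<open>p\<close>: the bound \<open>s\<close> keeps the quotients close,
        \<open>\<bar>h\<bar>\<close> keeps \<open>p\<close> away from 0, and the last term keeps
        \<open>p\<close> within the admissible range.\<close>
      define t where "t = min s (min \<bar>h\<bar> (1 / Suc m - \<bar>h\<bar>))"
      have "t > 0" using s h by (auto simp: t_def)
      then obtain p :: rat where p: "h < of_rat p" "of_rat p < h + t"
        using of_rat_dense[of h "h+t"] by auto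
      then have "\<bar>real_of_rat p - h\<bar> < t" by auto
      then have p': "\<bar>real_of_rat p - h\<bar> < s" "\<bar>real_of_rat p\<bar> < 1 / Suc m" "p \<noteq> 0"
        using h by (auto simp: t_def simp del: abs_of_rat)
      show ?thesis using s(2)[OF p'(1)] rat[OF p'(2,3)] k by (simp add: abs_if split: if_splits)
    qed
    then show "\<exists>s>0. \<forall>h. h \<noteq> 0 \<and> norm (h - 0) < s \<longrightarrow> norm (difference_quotient F x h - d) < e"
      by (intro exI[of _ "1 / Suc m"]) auto
  qed
  then show ?L unfolding DERIV_def difference_quotient_def by blast
qed

section \<open>The partial derivative of a copula\<close>

definition clamp01 :: "real \<Rightarrow> real" where "clamp01 x = max 0 (min 1 x)"

lemma clamp01_in [simp]: "0 \<le> clamp01 x" "clamp01 x \<le> 1"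
  and clamp01_id [simp]: "0 \<le> x \<Longrightarrow> x \<le> 1 \<Longrightarrow> clamp01 x = x"
  and clamp01_mono: "x \<le> y \<Longrightarrow> clamp01 x \<le> clamp01 y"
  and clamp01_lip: "x \<le> y \<Longrightarrow> clamp01 y - clamp01 x \<le> y - x"
  by (auto simp: clamp01_def)

text \<open>Continues the copula constantly across the edges of the square. The result is monotone
  and 1-Lipschitz in each variable on the whole line, so results for functions on the line apply to
  its sections.\<close>

definition ext :: "(real \<Rightarrow> real \<Rightarrow> real) \<Rightarrow> real \<Rightarrow> real \<Rightarrow> real" where
  "ext C u v = C (clamp01 u) (clamp01 v)"

lemma ext_eq [simp]: "0 \<le> u \<Longrightarrow> u \<le> 1 \<Longrightarrow> 0 \<le> v \<Longrightarrow> v \<le> 1 \<Longrightarrow> ext C u v = C u v"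
  by (simp add: ext_def)

lemma copula_boundary:
  assumes "is_copula C" "0 \<le> u" "u \<le> 1"
  shows "C u 0 = 0" "C 0 u = 0" "C u 1 = u" "C 1 u = u"
  using assms by (auto simp: is_copula_def)

lemma copula_2increasing:
  assumes "is_copula C" "0 \<le> u1" "u1 \<le> u2" "u2 \<le> 1" "0 \<le> v1" "v1 \<le> v2" "v2 \<le> 1"
  shows "C u2 v2 - C u2 v1 - C u1 v2 + C u1 v1 \<ge> 0"
  using assms unfolding is_copula_def by blast

text \<open>Both bounds are the rectangle inequality for a rectangle touching an edge where
  \<open>C\<close> is known: \<open>[u1, u2] \<times> [0, v]\<close> gives monotonicity,
  \<open>[u1, u2] \<times> [v, 1]\<close> the Lipschitz bound.\<close>

lemma copula_increment_fst:
  assumes "is_copula C" "0 \<le> u1" "u1 \<le> u2" "u2 \<le> 1" "0 \<le> v" "v \<le> 1"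
  shows "C u1 v \<le> C u2 v" "C u2 v - C u1 v \<le> u2 - u1"
  using copula_2increasing[of C u1 u2 0 v] copula_2increasing[of C u1 u2 v 1] assms
  by (auto simp: copula_boundary)

lemma copula_increment_snd:
  assumes "is_copula C" "0 \<le> v1" "v1 \<le> v2" "v2 \<le> 1" "0 \<le> u" "u \<le> 1"
  shows "C u v1 \<le> C u v2" "C u v2 - C u v1 \<le> v2 - v1"
  using copula_2increasing[of C 0 u v1 v2] copula_2increasing[of C u 1 v1 v2] assms
  by (auto simp: copula_boundary)

lemma ext_increment_fst:
  assumes "is_copula C" "x \<le> y"
  shows "ext C x v \<le> ext C y v" "ext C y v - ext C x v \<le> y - x"
  using copula_increment_fst[of C "clamp01 x" "clamp01 y" "clamp01 v"] assms
    clamp01_mono[of x y] clamp01_lip[of x y] by (auto simp: ext_def)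

lemma ext_increment_snd:
  assumes "is_copula C" "x \<le> y"
  shows "ext C u x \<le> ext C u y" "ext C u y - ext C u x \<le> y - x"
  using copula_increment_snd[of C "clamp01 x" "clamp01 y" "clamp01 u"] assms
    clamp01_mono[of x y] clamp01_lip[of x y] by (auto simp: ext_def)

lemma ext_diff_le:
  assumes "is_copula C"
  shows "\<bar>ext C u v - ext C u' v'\<bar> \<le> \<bar>u - u'\<bar> + \<bar>v - v'\<bar>"
proof -
  have "\<bar>ext C u v - ext C u' v\<bar> \<le> \<bar>u - u'\<bar>"
    using ext_increment_fst[OF assms, of u u' v] ext_increment_fst[OF assms, of u' u v]
    by (cases "u \<le> u'") auto
  moreover have "\<bar>ext C u' v - ext C u' v'\<bar> \<le> \<bar>v - v'\<bar>"
    using ext_increment_snd[OF assms, of v v' u'] ext_increment_snd[OF assms, of v' v u']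
    by (cases "v \<le> v'") auto
  ultimately show ?thesis by linarith
qed

lemma continuous_on_ext:
  assumes "is_copula C"
  shows "continuous_on UNIV (\<lambda>z. ext C (fst z) (snd z))"
proof (rule lipschitz_on_continuous_on[of 2])
  show "2-lipschitz_on UNIV (\<lambda>z. ext C (fst z) (snd z))"
  proof (rule lipschitz_onI)
    fix x y :: "real \<times> real"
    have "\<bar>fst x - fst y\<bar> \<le> dist x y" "\<bar>snd x - snd y\<bar> \<le> dist x y"
      using dist_fst_le[of x y] dist_snd_le[of x y] by (auto simp: dist_real_def)
    then show "dist (ext C (fst x) (snd x)) (ext C (fst y) (snd y)) \<le> 2 * dist x y"
      using ext_diff_le[OF assms, of "fst x" "snd x" "fst y" "snd y"] by (simp add: dist_real_def)
  qed auto
qed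

lemma continuous_on_ext_fst:
  assumes "is_copula C"
  shows "continuous_on UNIV (\<lambda>u. ext C u v)"
proof -
  have "continuous_on UNIV (\<lambda>u. (u, v))" by (intro continuous_intros)
  from continuous_on_compose2[OF continuous_on_ext[OF assms] this] show ?thesis by simp
qed

lemma ext_shift_measurable:
  assumes "is_copula C"
  shows "(\<lambda>z. ext C (fst z + h) (snd z)) \<in> borel_measurable borel"
proof -
  have "continuous_on UNIV (\<lambda>z::real \<times> real. (fst z + h, snd z))" by (intro continuous_intros)
  from continuous_on_compose2[OF continuous_on_ext[OF assms] this] show ?thesis
    by (intro borel_measurable_continuous_onI) simp
qed

lemma has_derivative_ext_iff:
  assumes "0 < u" "u < 1" "0 \<le> v" "v \<le> 1"
  shows "((\<lambda>t. ext C t v) has_real_derivative d) (at u) \<longleftrightarrow> ((\<lambda>t. C t v) has_real_derivative d) (at u)"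
proof (rule DERIV_cong_ev)
  have "eventually (\<lambda>t. t \<in> {0<..<1}) (nhds u)"
    by (rule eventually_nhds_in_open) (use assms in auto)
  then show "eventually (\<lambda>t. ext C t v = C t v) (nhds u)"
    by eventually_elim (use assms in auto)
qed auto

lemma d1_eq:
  assumes "((\<lambda>t. C t v) has_real_derivative d) (at u)"
  shows "d1 C u v = d"
  using assms DERIV_unique unfolding d1_def by (metis (mono_tags, lifting) someI_ex)

text \<open>Cut off at the boundary, where \<open>d1\<close> depends on the unspecified values of \<open>C\<close> outside the
  square.\<close>
definition square_d1 :: "(real \<Rightarrow> real \<Rightarrow> real) \<Rightarrow> real \<times> real \<Rightarrow> real" where
  "square_d1 C z = (if z \<in> {0<..<1} \<times> {0<..<1} then d1 C (fst z) (snd z) else 0)"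

lemma differentiable_set_measurable:
  assumes C: "is_copula C"
  shows "{z. \<exists>d. ((\<lambda>t. ext C t (snd z)) has_real_derivative d) (at (fst z))} \<in> sets borel"
proof -
  define q where "q = (\<lambda>h z. difference_quotient (\<lambda>t. ext C t (snd z)) (fst z) h)"
  have q[measurable]: "q h \<in> borel_measurable borel" for h
    using ext_shift_measurable[OF C, of h] ext_shift_measurable[OF C, of 0]
    unfolding q_def difference_quotient_def by simp
  have "{z. \<forall>k::nat. \<exists>m::nat. \<forall>p r::rat.
        \<bar>real_of_rat p\<bar> < 1 / Suc m \<and> p \<noteq> 0 \<and> \<bar>real_of_rat r\<bar> < 1 / Suc m \<and> r \<noteq> 0 \<longrightarrow>
        \<bar>q (of_rat p) z - q (of_rat r) z\<bar> \<le> 1 / Suc k} \<in> sets borel"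
    by measurable
  then show ?thesis
    unfolding differentiable_iff_rational_Cauchy[OF continuous_on_ext_fst[OF C]] q_def .
qed

text \<open>On the Borel set of differentiability inside the open square the derivative is the
  pointwise limit of the quotients with increment \<open>1 / Suc n\<close>; everywhere else the
  default value 0 is taken.\<close>

lemma square_d1_measurable:
  assumes C: "is_copula C"
  shows "square_d1 C \<in> borel_measurable borel"
proof -
  define q where "q = (\<lambda>h z. (ext C (fst z + h) (snd z) - ext C (fst z) (snd z)) / h)"
  have q[measurable]: "q h \<in> borel_measurable borel" for h
    using ext_shift_measurable[OF C, of h] ext_shift_measurable[OF C, of 0]
    unfolding q_def by simp
  define G where "G = {z. \<exists>d. ((\<lambda>t. ext C t (snd z)) has_real_derivative d) (at (fst z))}"
  have G[measurable]: "G \<in> sets borel"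
    unfolding G_def by (rule differentiable_set_measurable[OF C])
  have G_iff: "z \<in> G \<longleftrightarrow> (\<exists>d. ((\<lambda>t. ext C t (snd z)) has_real_derivative d) (at (fst z)))" for z
    by (simp add: G_def)
  have sq[measurable]: "{0<..<1} \<times> {0<..<1} \<in> sets (borel :: (real \<times> real) measure)"
    by (intro borel_open open_Times) auto
  have "square_d1 C z = (if z \<in> ({0<..<1} \<times> {0<..<1}) \<inter> G then lim (\<lambda>n. q (1 / Suc n) z) else 0)" for z
  proof (cases "z \<in> {0<..<1} \<times> {0<..<1}")
    case True
    then have z: "0 < fst z" "fst z < 1" "0 \<le> snd z" "snd z \<le> 1" by auto
    note iff = has_derivative_ext_iff[OF z, of C]
    show ?thesis
    proof (cases "z \<in> G")
      case T: True
      then obtain d where d: "((\<lambda>t. ext C t (snd z)) has_real_derivative d) (at (fst z))"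
        using G_iff by blast
      have "((\<lambda>h. q h z) \<longlongrightarrow> d) (at 0)"
        using d unfolding DERIV_def q_def .
      moreover have "filterlim (\<lambda>n. 1 / real (Suc n)) (at 0) sequentially"
        using LIMSEQ_Suc[OF lim_1_over_n] by (intro filterlim_atI) auto
      ultimately have "(\<lambda>n. q (1 / Suc n) z) \<longlonglongrightarrow> d"
        by (rule filterlim_compose)
      then have "lim (\<lambda>n. q (1 / Suc n) z) = d" by (rule limI)
      then show ?thesis using True T d1_eq[of C "snd z" d "fst z"] d iff by (simp add: square_d1_def)
    next
      case False
      then show ?thesis using True G_iff[of z] iff by (simp add: square_d1_def d1_def)
    qed
  qed (simp add: square_d1_def)
  moreover have "(\<lambda>z. if z \<in> ({0<..<1} \<times> {0<..<1}) \<inter> G then lim (\<lambda>n. q (1 / Suc n) z) else 0)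
     \<in> borel_measurable borel"
    by measurable
  ultimately show ?thesis by presburger
qed

text \<open>A section of \<open>ext C\<close> is monotone and 1-Lipschitz, hence has a density,
  which is its derivative almost everywhere. Since \<open>square_d1\<close> agrees with it almost
  everywhere, the fundamental theorem of calculus holds for \<open>square_d1\<close>.\<close>

lemma AE_ext_has_derivative:
  assumes C: "is_copula C" and v: "0 < v" "v < 1"
  shows "AE u in lborel. ((\<lambda>t. ext C t v) has_real_derivative square_d1 C (u, v)) (at u)"
    and has_integral_square_d1: "a \<le> b \<Longrightarrow>
      ((\<lambda>u. square_d1 C (u, v)) has_integral (ext C b v - ext C a v)) {a..b}"
proof -
  let ?F = "\<lambda>t. ext C t v"
  obtain g where g: "\<And>a b. a \<le> b \<Longrightarrow> (g has_integral (?F b - ?F a)) {a..b}"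
    using mono_lipschitz_density[of ?F] ext_increment_fst[OF C] by metis
  \<comment> \<open>Outside \<open>[0, 1]\<close> the section is locally constant, so its derivative
    is 0, which matches the cut-off. Only the kinks at 0 and 1 are left out.\<close>
  have eq: "square_d1 C (u, v) = g u"
    if d: "(?F has_real_derivative g u) (at u)" and u: "u \<noteq> 0" "u \<noteq> 1" for u
  proof -
    consider "u < 0" | "0 < u" "u < 1" | "u > 1" using u by linarith
    then show ?thesis
    proof cases
      case 1
      have "eventually (\<lambda>t. t \<in> {..<0}) (nhds u)"
        by (rule eventually_nhds_in_open) (use 1 in auto)
      then have ev: "eventually (\<lambda>t. ?F t = C 0 v) (nhds u)"
        by eventually_elim (use v in \<open>auto simp: ext_def clamp01_def\<close>)
      have "(?F has_real_derivative 0) (at u)"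
        using DERIV_cong_ev[OF refl ev refl] by simp
      then have "g u = 0" using d DERIV_unique by blast
      then show ?thesis using 1 by (simp add: square_d1_def)
    next
      case 2
      then show ?thesis
        using d has_derivative_ext_iff[of u v C] v d1_eq[of C v "g u" u]
        by (simp add: square_d1_def)
    next
      case 3
      have "eventually (\<lambda>t. t \<in> {1<..}) (nhds u)"
        by (rule eventually_nhds_in_open) (use 3 in auto)
      then have ev: "eventually (\<lambda>t. ?F t = C 1 v) (nhds u)"
        by eventually_elim (use v in \<open>auto simp: ext_def clamp01_def\<close>)
      have "(?F has_real_derivative 0) (at u)"
        using DERIV_cong_ev[OF refl ev refl] by simp
      then have "g u = 0" using d DERIV_unique by blast
      then show ?thesis using 3 by (simp add: square_d1_def)
    qed
  qed
  have der: "AE u in lborel. (?F has_real_derivative g u) (at u)"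
    by (rule AE_has_derivative_of_density) (rule g)
  have ae: "AE u in lborel. (?F has_real_derivative g u) (at u) \<and> square_d1 C (u, v) = g u"
    using der AE_lborel_singleton[of 0] AE_lborel_singleton[of 1]
    by eventually_elim (use eq in auto)
  then show "AE u in lborel. (?F has_real_derivative square_d1 C (u, v)) (at u)"
    by eventually_elim auto
  assume ab: "a \<le> b"
  have "AE u in lborel. u \<in> {a..b} \<longrightarrow> square_d1 C (u, v) = g u"
    using ae by eventually_elim auto
  from has_integral_AE[OF this] g[OF ab]
  show "((\<lambda>u. square_d1 C (u, v)) has_integral (ext C b v - ext C a v)) {a..b}"
    by blast
qed

text \<open>Where the derivative \<open>d\<close> exists, both \<open>t \<mapsto> ext C t v\<close>
  and \<open>t \<mapsto> t - ext C t v\<close> are monotone, so \<open>d\<close> and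
  \<open>1 - d\<close> are nonnegative; elsewhere the default value 0 obeys the bounds.\<close>

lemma square_d1_bounds:
  assumes C: "is_copula C"
  shows "0 \<le> square_d1 C z" "square_d1 C z \<le> 1"
proof -
  have "0 \<le> square_d1 C z \<and> square_d1 C z \<le> 1"
  proof (cases "z \<in> {0<..<1} \<times> {0<..<1} \<and>
      (\<exists>d. ((\<lambda>t. C t (snd z)) has_real_derivative d) (at (fst z)))")
    case True
    then obtain d where z: "z \<in> {0<..<1} \<times> {0<..<1}"
      and d: "((\<lambda>t. C t (snd z)) has_real_derivative d) (at (fst z))" by blast
    then have "square_d1 C z = d" by (simp add: square_d1_def d1_eq)
    moreover have d': "((\<lambda>t. ext C t (snd z)) has_real_derivative d) (at (fst z))"
      using d z by (subst has_derivative_ext_iff) auto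
    then have "d \<ge> 0"
      by (rule mono_on_imp_deriv_nonneg[where A=UNIV, rotated])
         (use ext_increment_fst(1)[OF C] in \<open>auto intro!: mono_onI\<close>)
    moreover have "((\<lambda>t. t - ext C t (snd z)) has_real_derivative 1 - d) (at (fst z))"
      by (intro derivative_intros d')
    then have "1 - d \<ge> 0"
      by (rule mono_on_imp_deriv_nonneg[where A=UNIV, rotated])
         (use ext_increment_fst(2)[OF C] in \<open>auto intro!: mono_onI simp: algebra_simps\<close>)
    ultimately show ?thesis by simp
  qed (auto simp: square_d1_def d1_def)
  then show "0 \<le> square_d1 C z" "square_d1 C z \<le> 1" by auto
qed

lemma square_d1_outside:
  "square_d1 C (u, v) = 0" if "\<not> (0 < u \<and> u < 1 \<and> 0 < v \<and> v < 1)"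
  using that by (auto simp: square_d1_def)

text \<open>Fubini turns the statement about almost every point of each horizontal section into one
  about almost every point of the square; this rests on the set of differentiability being
  Borel.\<close>

lemma AE_square_has_derivative:
  assumes C: "is_copula C"
  shows "AE z in lborel. z \<in> {0<..<1} \<times> {0<..<1} \<longrightarrow>
    ((\<lambda>t. ext C t (snd z)) has_real_derivative square_d1 C z) (at (fst z))"
proof -
  let ?P = "\<lambda>z. z \<in> {0<..<1} \<times> {0<..<1} \<longrightarrow>
    (\<exists>d. ((\<lambda>t. ext C t (snd z)) has_real_derivative d) (at (fst z)))"
  have [measurable]: "{0<..<1} \<times> {0<..<1} \<in> sets (borel :: (real \<times> real) measure)"
    by (intro borel_open open_Times) auto
  note [measurable] = differentiable_set_measurable[OF C]
  have m: "{z. ?P z} \<in> sets borel"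
  proof -
    have "{z. ?P z} = (- ({0<..<1} \<times> {0<..<1})) \<union>
      {z. \<exists>d. ((\<lambda>t. ext C t (snd z)) has_real_derivative d) (at (fst z))}" by auto
    also have "\<dots> \<in> sets borel" by measurable
    finally show ?thesis .
  qed
  have sec: "AE v in lborel. AE u in lborel. ?P (u, v)"
  proof (rule AE_I2)
    fix v :: real
    show "AE u in lborel. ?P (u, v)"
    proof (cases "0 < v \<and> v < 1")
      case True
      then show ?thesis
        using AE_ext_has_derivative[OF C, of v] by (auto elim!: eventually_mono)
    qed auto
  qed
  have sets_eq: "sets (lborel \<Otimes>\<^sub>M lborel) = sets (borel :: (real \<times> real) measure)"
    unfolding lborel_prod by simp
  \<comment> \<open>The sections come with \<open>v\<close> as the outer variable, while the product
    measure is treated with \<open>u\<close> outside. Exchanging the two requires the swapped set to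
    be measurable.\<close>
  have sw: "{z \<in> space (lborel \<Otimes>\<^sub>M lborel). ?P (snd z, fst z)} \<in> sets (lborel \<Otimes>\<^sub>M lborel)"
  proof -
    have "(\<lambda>z::real\<times>real. (snd z, fst z)) \<in> borel_measurable borel" 
      by (intro borel_measurable_continuous_onI continuous_intros)
    from measurable_sets[OF this m] show ?thesis
      unfolding sets_eq by (simp add: vimage_def space_pair_measure)
  qed
  have "AE u in lborel. AE v in lborel. ?P (u, v)"
    using sec lborel_pair.AE_commute[OF sw] by simp
  then have "AE z in (lborel \<Otimes>\<^sub>M lborel). ?P z"
    using m by (intro lborel_pair.AE_pair_measure) (simp_all only: sets_eq space_pair_measure
        space_lborel space_borel UNIV_Times_UNIV UNIV_I simp_thms)
  then have "AE z in lborel. ?P z" unfolding lborel_prod .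
  then show ?thesis
  proof eventually_elim
    case (elim z)
    show ?case
    proof
      assume z: "z \<in> {0<..<1} \<times> {0<..<1}"
      then obtain d where "((\<lambda>t. ext C t (snd z)) has_real_derivative d) (at (fst z))"
        using elim by blast
      then show "((\<lambda>t. ext C t (snd z)) has_real_derivative square_d1 C z) (at (fst z))"
        using z has_derivative_ext_iff[of "fst z" "snd z" C] d1_eq[of C "snd z" d "fst z"]
        by (auto simp: square_d1_def)
    qed
  qed
qed

section \<open>Integrability and the energies\<close>

lemma integrable_bounded_on_square:
  fixes f :: "real \<times> real \<Rightarrow> real"
  assumes [measurable]: "f \<in> borel_measurable borel"
    and "\<And>z. \<bar>f z\<bar> \<le> B" and "\<And>z. z \<notin> {0<..<1} \<times> {0<..<1} \<Longrightarrow> f z = 0"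
  shows "integrable lborel f"
proof (rule Bochner_Integration.integrable_bound)
  show "integrable lborel (\<lambda>z. indicator (cbox (0,0) (1,1)) (z::real\<times>real) *\<^sub>R B :: real)"
    by (intro integrable_indicator) (auto simp: emeasure_lborel_cbox_eq)
  show "AE z in lborel. norm (f z) \<le> norm (indicator (cbox (0,0) (1,1)) z *\<^sub>R B)"
  proof (rule AE_I2)
    fix z :: "real \<times> real"
    show "norm (f z) \<le> norm (indicator (cbox (0,0) (1,1)) z *\<^sub>R B)"
    proof (cases "z \<in> {0<..<1} \<times> {0<..<1}")
      case True
      then have "z \<in> cbox (0,0) (1,1)" by (cases z) auto
      then show ?thesis using assms(2)[of z] by simp
    qed (simp add: assms(3))
  qed
qed auto

definition energy :: "(real \<Rightarrow> real \<Rightarrow> real) \<Rightarrow> real" where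
  "energy C = (LINT z|lborel. (square_d1 C z)\<^sup>2)"

definition section_energy :: "(real \<Rightarrow> real \<Rightarrow> real) \<Rightarrow> real \<Rightarrow> real" where
  "section_energy C v = (LINT u|lborel. (square_d1 C (u, v))\<^sup>2)"

lemma integrable_square_d1_mult:
  assumes "is_copula C" "is_copula E"
  shows "integrable lborel (\<lambda>z. square_d1 C z * square_d1 E z)"
proof (rule integrable_bounded_on_square[where B=1])
  show "(\<lambda>z. square_d1 C z * square_d1 E z) \<in> borel_measurable borel"
    using square_d1_measurable[OF assms(1)] square_d1_measurable[OF assms(2)] by simp
  show "\<bar>square_d1 C z * square_d1 E z\<bar> \<le> 1" for z
    using square_d1_bounds[OF assms(1), of z] square_d1_bounds[OF assms(2), of z]
    by (simp add: abs_mult mult_le_one)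
qed (auto simp: square_d1_def)

lemma integrable_square_d1_power2:
  assumes "is_copula C"
  shows "integrable lborel (\<lambda>z. (square_d1 C z)\<^sup>2)"
  using integrable_square_d1_mult[OF assms assms] by (simp add: power2_eq_square)

text \<open>The integrands differ only on the boundary of the square, a null set, where
  \<open>d1\<close> may be arbitrary.\<close>

lemma xi_eq_energy:
  assumes C: "is_copula C"
  shows "xi C = 6 * energy C - 2"
proof -
  have "((\<lambda>z. (square_d1 C z)\<^sup>2) has_integral energy C) UNIV"
    unfolding energy_def by (rule has_integral_integral_real) (rule integrable_square_d1_power2[OF C])
  moreover have "(\<lambda>z. (square_d1 C z)\<^sup>2)
      = (\<lambda>z. if z \<in> box (0,0) (1,1) then (d1 C (fst z) (snd z))\<^sup>2 else 0)"
    by (auto simp: square_d1_def mem_box Basis_prod_def fun_eq_iff)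
  ultimately have "((\<lambda>z. (d1 C (fst z) (snd z))\<^sup>2) has_integral energy C) (box (0,0) (1,1))"
    by (simp only: has_integral_restrict_UNIV)
  then have "((\<lambda>z. (d1 C (fst z) (snd z))\<^sup>2) has_integral energy C) (cbox (0,0) (1,1))"
    by (rule has_integral_spike_set_eq[THEN iffD1, rotated -1])
       (auto intro!: negligible_subset[OF negligible_frontier_interval[of "(0,0)" "(1,1)"]]
         dest: box_subset_cbox[THEN subsetD])
  from integral_unique[OF this] show ?thesis
    unfolding xi_def case_prod_beta' by linarith
qed

lemma integrable_section_energy:
  assumes C: "is_copula C"
  shows "integrable lborel (section_energy C)"
    and energy_eq_section: "energy C = (LINT v|lborel. section_energy C v)"
proof -
  have i: "integrable (lborel \<Otimes>\<^sub>M lborel) (\<lambda>(u, v). (square_d1 C (u, v))\<^sup>2)"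
    using integrable_square_d1_power2[OF C] by (simp add: lborel_prod case_prod_beta')
  show "integrable lborel (section_energy C)"
    unfolding section_energy_def using lborel_pair.integrable_snd[OF i] .
  show "energy C = (LINT v|lborel. section_energy C v)"
    unfolding section_energy_def lborel_pair.integral_snd[OF i] energy_def
    by (simp add: lborel_prod case_prod_beta')
qed

lemma section_energy_outside: "\<not> (0 < v \<and> v < 1) \<Longrightarrow> section_energy C v = 0"
  by (simp add: section_energy_def square_d1_outside)

lemma section_measurable:
  assumes "is_copula C"
  shows "(\<lambda>u. square_d1 C (u, v)) \<in> borel_measurable borel"
  by (rule measurable_compose[OF _ square_d1_measurable[OF assms]])
     (intro borel_measurable_continuous_onI continuous_intros)

lemma integrable_bounded_on_interval:
  fixes f :: "real \<Rightarrow> real"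
  assumes [measurable]: "f \<in> borel_measurable borel"
    and "\<And>z. \<bar>f z\<bar> \<le> B" and "\<And>z. z \<notin> {0<..<1} \<Longrightarrow> f z = 0"
  shows "integrable lborel f"
proof (rule Bochner_Integration.integrable_bound)
  show "integrable lborel (\<lambda>z. indicator {0..1} (z::real) *\<^sub>R B :: real)"
    by (intro integrable_indicator) auto
  show "AE z in lborel. norm (f z) \<le> norm (indicator {0..1} z *\<^sub>R B)"
  proof (rule AE_I2)
    fix z
    show "norm (f z) \<le> norm (indicator {0..1} z *\<^sub>R B)"
    proof (cases "z \<in> {0<..<1}")
      case True
      then show ?thesis using assms(2)[of z] by simp
    qed (simp add: assms(3))
  qed
qed auto

lemma integrable_section_power2:
  assumes C: "is_copula C"
  shows "integrable lborel (\<lambda>u. (square_d1 C (u, v))\<^sup>2)"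
proof (rule integrable_bounded_on_interval[where B=1])
  show "(\<lambda>u. (square_d1 C (u, v))\<^sup>2) \<in> borel_measurable borel"
    using section_measurable[OF C] by simp
  show "\<bar>(square_d1 C (u, v))\<^sup>2\<bar> \<le> 1" for u
    using square_d1_bounds[OF C, of "(u,v)"] by (simp add: power_le_one)
qed (auto simp: square_d1_outside)

lemma section_energy_has_integral:
  assumes C: "is_copula C"
  shows "((\<lambda>u. (square_d1 C (u, v))\<^sup>2) has_integral section_energy C v) {0..1}"
proof -
  from has_integral_integral_real[OF integrable_section_power2[OF C]]
  have "((\<lambda>u. (square_d1 C (u, v))\<^sup>2) has_integral section_energy C v) UNIV"
    by (simp add: section_energy_def)
  then have "((\<lambda>u. if u \<in> {0..1} then (square_d1 C (u, v))\<^sup>2 else 0) has_integral section_energy C v) UNIV"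
    by (rule has_integral_eq[rotated]) (auto simp: square_d1_def)
  then show ?thesis by (simp only: has_integral_restrict_UNIV)
qed

lemma section_energy_integral:
  assumes C: "is_copula C"
  shows "(section_energy C has_integral energy C) {0..1}"
proof -
  have "(section_energy C has_integral energy C) UNIV"
    using has_integral_integral_real[OF integrable_section_energy(1)[OF C]]
    by (simp add: energy_eq_section[OF C])
  then have "((\<lambda>v. if v \<in> {0..1} then section_energy C v else 0) has_integral energy C) UNIV"
    by (rule has_integral_eq[rotated]) (auto simp: section_energy_outside)
  then show ?thesis by (simp only: has_integral_restrict_UNIV)
qed

section \<open>Inequalities between the two functionals\<close>

lemma has_integral_polynomial_01:
  "((\<lambda>v. v\<^sup>2) has_integral (1/3::real)) {0..1}"
  "((\<lambda>v. v * (1 - v)) has_integral (1/6::real)) {0..1}"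
  "((\<lambda>v. v) has_integral (1/2::real)) {0..1}"
proof -
  have "((\<lambda>v. v\<^sup>2) has_integral (1^3/3 - 0^3/3 :: real)) {0..1}"
    by (rule fundamental_theorem_of_calculus)
       (auto intro!: derivative_eq_intros simp flip: has_real_derivative_iff_has_vector_derivative)
  then show "((\<lambda>v. v\<^sup>2) has_integral (1/3::real)) {0..1}" by simp
  have "((\<lambda>v. v * (1 - v)) has_integral ((1^2/2 - 1^3/3) - (0^2/2 - 0^3/3) :: real)) {0..1}"
    by (rule fundamental_theorem_of_calculus)
       (auto intro!: derivative_eq_intros simp: power2_eq_square algebra_simps
         simp flip: has_real_derivative_iff_has_vector_derivative)
  then show "((\<lambda>v. v * (1 - v)) has_integral (1/6::real)) {0..1}" by simp
  have "((\<lambda>v. v) has_integral (1^2/2 - 0^2/2 :: real)) {0..1}"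
    by (rule fundamental_theorem_of_calculus)
       (auto intro!: derivative_eq_intros simp flip: has_real_derivative_iff_has_vector_derivative)
  then show "((\<lambda>v. v) has_integral (1/2::real)) {0..1}" by simp
qed

lemma continuous_on_diagonal:
  assumes C: "is_copula C"
  shows "continuous_on {0..1} (\<lambda>v. C v v)"
proof -
  have "continuous_on {0..1} (\<lambda>v::real. (v, v))" by (intro continuous_intros)
  from continuous_on_compose2[OF continuous_on_ext[OF C] this]
  have "continuous_on {0..1} (\<lambda>v. ext C v v)" by simp
  then show ?thesis by (rule continuous_on_eq) auto
qed

lemma diagonal_has_integral:
  assumes C: "is_copula C"
  shows "((\<lambda>v. C v v) has_integral (psi C + 2) / 6) {0..1}"
proof -
  have "(\<lambda>v. C v v) integrable_on {0..1}"
    by (rule integrable_continuous_real) (rule continuous_on_diagonal[OF C])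
  then show ?thesis by (simp add: psi_def has_integral_iff)
qed

lemma diagonal_bounds:
  assumes "is_copula C" "0 \<le> v" "v \<le> 1"
  shows "0 \<le> C v v" "2 * v - 1 \<le> C v v" "C v v \<le> v"
  using assms copula_increment_fst[of C 0 v v] copula_increment_fst[of C v 1 v]
  by (auto simp: copula_boundary)

lemma psi_bounds:
  assumes C: "is_copula C"
  shows "- 1/2 \<le> psi C" "psi C \<le> 1"
proof -
  note d = diagonal_has_integral[OF C]
  have "(psi C + 2) / 6 \<le> 1 / 2"
    by (rule has_integral_le[OF d has_integral_polynomial_01(3)])
       (use diagonal_bounds[OF C] in auto)
  then show "psi C \<le> 1" by simp
  \<comment> \<open>The lower bound \<open>max 0 (2 * v - 1)\<close> of the diagonal changes its
    branch at \<open>1/2\<close>, and its integral is \<open>1/4\<close>.\<close>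
  have 1: "((\<lambda>v. 0) has_integral (0::real)) {0..1/2::real}" by simp
  have 2: "((\<lambda>v. 2 * v - 1) has_integral (1^2 - 1) - ((1/2)^2 - 1/2)) {1/2..1::real}"
    by (rule fundamental_theorem_of_calculus)
       (auto intro!: derivative_eq_intros simp flip: has_real_derivative_iff_has_vector_derivative)
  have 3: "(\<lambda>v. C v v) integrable_on {0..1}" using d by blast
  have i: "(\<lambda>v. C v v) integrable_on {0..1/2}" "(\<lambda>v. C v v) integrable_on {1/2..1}"
    by (rule integrable_subinterval_real[OF 3]; simp)+
  have "0 \<le> integral {0..1/2} (\<lambda>v. C v v)"
    by (rule has_integral_le[OF 1 integrable_integral[OF i(1)]]) (use diagonal_bounds[OF C] in auto)
  moreover have "(1^2 - 1) - ((1/2)^2 - 1/2) \<le> integral {1/2..1} (\<lambda>v. C v v)"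
    by (rule has_integral_le[OF 2 integrable_integral[OF i(2)]]) (use diagonal_bounds[OF C] in auto)
  moreover have "integral {0..1/2} (\<lambda>v. C v v) + integral {1/2..1} (\<lambda>v. C v v) = (psi C + 2) / 6"
    using Henstock_Kurzweil_Integration.integral_combine[OF _ _ 3, of "1/2"] integral_unique[OF d] by simp
  ultimately show "- 1/2 \<le> psi C" by (simp add: power2_eq_square)
qed

text \<open>Compares the section with the two-level function that takes the value \<open>v + l * (1 - v)\<close> on
  \<open>[0, v]\<close> and \<open>v - l * v\<close> on \<open>[v, 1]\<close>.\<close>
lemma section_energy_ge:
  assumes C: "is_copula C" and v: "0 < v" "v < 1"
  shows "section_energy C v \<ge> v\<^sup>2 + 2 * l * (C v v - v\<^sup>2) - l\<^sup>2 * (v * (1 - v))"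
proof -
  let ?f = "\<lambda>u. square_d1 C (u, v)"
  have S: "((\<lambda>u. (?f u)\<^sup>2) has_integral section_energy C v) {0..1}"
    by (rule section_energy_has_integral[OF C])
  then have S': "(\<lambda>u. (?f u)\<^sup>2) integrable_on {0..1}" by blast
  have i: "(\<lambda>u. (?f u)\<^sup>2) integrable_on {0..v}" "(\<lambda>u. (?f u)\<^sup>2) integrable_on {v..1}"
    by (rule integrable_subinterval_real[OF S']; use v in simp)+
  have sum: "integral {0..v} (\<lambda>u. (?f u)\<^sup>2) + integral {v..1} (\<lambda>u. (?f u)\<^sup>2) = section_energy C v"
    using Henstock_Kurzweil_Integration.integral_combine[OF _ _ S', of v] integral_unique[OF S] v by simp
  \<comment> \<open>Integrates the tangent line inequality \<open>f^2 \<ge> 2 * p * f - p^2\<close>,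
    which is \<open>(f - p)^2 \<ge> 0\<close>, for a constant level \<open>p\<close>.\<close>
  have tangent: "2 * p * (ext C b v - ext C a v) - p\<^sup>2 * (b - a) \<le> integral {a..b} (\<lambda>u. (?f u)\<^sup>2)"
    if "a \<le> b" "(\<lambda>u. (?f u)\<^sup>2) integrable_on {a..b}" for a b p
  proof (rule has_integral_le)
    show "((\<lambda>u. 2 * p * ?f u - p\<^sup>2) has_integral 2 * p * (ext C b v - ext C a v) - p\<^sup>2 * (b - a)) {a..b}"
      using that has_integral_const_real[of "p\<^sup>2" a b]
      by (intro has_integral_diff has_integral_mult_right has_integral_square_d1 C v) (simp_all add: mult.commute)
    show "((\<lambda>u. (?f u)\<^sup>2) has_integral integral {a..b} (\<lambda>u. (?f u)\<^sup>2)) {a..b}"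
      using that(2) by (rule integrable_integral)
    show "2 * p * ?f u - p\<^sup>2 \<le> (?f u)\<^sup>2" for u
      using zero_le_power2[of "?f u - p"] by (simp add: power2_diff mult_ac)
  qed
  \<comment> \<open>The slope \<open>l\<close> stays free, which keeps the bound affine in
    \<open>C v v\<close>. The optimal choice \<open>(C v v - v^2) / (v * (1 - v))\<close> would give
    the quadratic bound.\<close>
  let ?p = "v + l * (1 - v)" and ?q = "v - l * v"
  have b: "ext C 0 v = 0" "ext C v v = C v v" "ext C 1 v = v"
    using v by (auto simp: copula_boundary[OF C])
  have "2 * ?p * C v v - ?p\<^sup>2 * v + (2 * ?q * (v - C v v) - ?q\<^sup>2 * (1 - v)) \<le> section_energy C v"
    using tangent[OF _ i(1), of ?p] tangent[OF _ i(2), of ?q] v sum unfolding b by simp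
  moreover have "2 * ?p * C v v - ?p\<^sup>2 * v + (2 * ?q * (v - C v v) - ?q\<^sup>2 * (1 - v))
      = v\<^sup>2 + 2 * l * (C v v - v\<^sup>2) - l\<^sup>2 * (v * (1 - v))"
    by algebra
  ultimately show ?thesis by simp
qed

text \<open>The derivative lies in \<open>[0, 1]\<close>, so its square is at most itself, and its
  integral over the section is \<open>v\<close>.\<close>

lemma section_energy_le:
  assumes C: "is_copula C" and v: "0 < v" "v < 1"
  shows "section_energy C v \<le> v"
proof -
  have "section_energy C v \<le> ext C 1 v - ext C 0 v"
  proof (rule has_integral_le[OF section_energy_has_integral[OF C] has_integral_square_d1[OF C v]])
    show "(square_d1 C (u, v))\<^sup>2 \<le> square_d1 C (u, v)" for u
      using square_d1_bounds[OF C, of "(u, v)"] by (simp add: power2_eq_square mult_left_le)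
  qed simp
  then show ?thesis using v by (simp add: copula_boundary[OF C])
qed

lemma xi_le_1:
  assumes C: "is_copula C"
  shows "xi C \<le> 1"
proof -
  have "energy C \<le> 1/2"
  proof (rule has_integral_le)
    show "(section_energy C has_integral energy C) {0<..<1}"
      using section_energy_integral[OF C] by (simp add: has_integral_Icc_iff_Ioo)
    show "((\<lambda>v. v) has_integral (1/2::real)) {0<..<1}"
      using has_integral_polynomial_01(3) by (simp add: has_integral_Icc_iff_Ioo)
  qed (use section_energy_le[OF C] in auto)
  then show ?thesis by (simp add: xi_eq_energy[OF C])
qed

text \<open>Cauchy-Schwarz in dual form: one slope \<open>l\<close> for all sections yields
  \<open>xi C \<ge> 2 * l * psi C - l^2\<close>, and \<open>l = psi C\<close> is the best
  choice.\<close>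

lemma psi_power2_le_xi:
  assumes C: "is_copula C"
  shows "(psi C)\<^sup>2 \<le> xi C"
proof -
  let ?l = "psi C"
  have "((\<lambda>v. v\<^sup>2 + 2 * ?l * (C v v - v\<^sup>2) - ?l\<^sup>2 * (v * (1 - v))) has_integral
      1/3 + 2 * ?l * ((psi C + 2) / 6 - 1/3) - ?l\<^sup>2 * (1/6)) {0..1}"
    by (intro has_integral_add has_integral_diff has_integral_mult_right
        has_integral_polynomial_01 diagonal_has_integral[OF C])
  then have i: "((\<lambda>v. v\<^sup>2 + 2 * ?l * (C v v - v\<^sup>2) - ?l\<^sup>2 * (v * (1 - v))) has_integral
      1/3 + 2 * ?l * ((psi C + 2) / 6 - 1/3) - ?l\<^sup>2 * (1/6)) {0<..<1}"
    by (simp only: has_integral_Icc_iff_Ioo)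
  have "(section_energy C has_integral energy C) {0<..<1}"
    using section_energy_integral[OF C] by (simp only: has_integral_Icc_iff_Ioo)
  from has_integral_le[OF i this]
  have "1/3 + 2 * ?l * ((psi C + 2) / 6 - 1/3) - ?l\<^sup>2 * (1/6) \<le> energy C"
    by (simp add: section_energy_ge[OF C])
  then show ?thesis by (simp add: xi_eq_energy[OF C] power2_eq_square field_simps)
qed

section \<open>The cubic equation and the lower boundary\<close>

text \<open>In the cubic \<open>y\<close> occurs only through \<open>2 * y * (m + 2)^2\<close>, so a
  root determines \<open>y\<close> as a rational function of
  \<open>t = m + 2 = 2 / v\<close>.\<close>

lemma mu_cubic_root_value:
  assumes "0 \<le> m" "mu_cubic y m = 0"
  defines "v \<equiv> 2 / (2 + m)"
  shows "y = - 2 * v\<^sup>2 + 6 * v - 5 + 1 / v"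
proof -
  define t where "t = m + 2"
  have t: "t \<noteq> 0" "m = t - 2" "v = 2 / t" using assms(1) by (auto simp: t_def v_def add.commute)
  have "2 * y * t\<^sup>2 = t^3 - 10 * t^2 + 24 * t - 16"
    using assms(2) unfolding mu_cubic_def t(2)
    by (simp add: power2_eq_square power3_eq_cube algebra_simps)
  then have "y = (t^3 - 10 * t^2 + 24 * t - 16) / (2 * t\<^sup>2)"
    using t(1) by (simp add: field_simps)
  also have "\<dots> = - 2 * v\<^sup>2 + 6 * v - 5 + 1 / v"
    using t(1) unfolding t(3) by (simp add: field_simps power2_eq_square power3_eq_cube)
  finally show ?thesis .
qed

text \<open>The cubic equals \<open>- 8 * y \<ge> 0\<close> at 0 and
  \<open>- 16 - 32 * y \<le> 0\<close> at 2, so it has a root in between. Two roots would correspond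
  to distinct points of \<open>[1/2, 1]\<close> with the same value of
  \<open>- 2 * v^2 + 6 * v - 5 + 1 / v\<close>.\<close>

lemma mu_cubic_unique_root:
  assumes y: "- 1/2 \<le> y" "y \<le> 0"
  shows "\<exists>!m. m \<in> {0..2} \<and> mu_cubic y m = 0"
proof -
  have "\<exists>m. 0 \<le> m \<and> m \<le> 2 \<and> mu_cubic y m = 0"
  proof (rule IVT2')
    show "mu_cubic y 2 \<le> 0" "0 \<le> mu_cubic y 0" using y by (auto simp: mu_cubic_def)
    show "continuous_on {0..2} (mu_cubic y)" unfolding mu_cubic_def by (intro continuous_intros)
  qed auto
  moreover have "m = m'" if m: "m \<in> {0..2}" "mu_cubic y m = 0" and m': "m' \<in> {0..2}" "mu_cubic y m' = 0"
    for m m'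
  proof (rule ccontr)
    assume ne: "m \<noteq> m'"
    define p q where "p = 2 / (2 + m)" and "q = 2 / (2 + m')"
    have pq: "1/2 \<le> p" "p \<le> 1" "1/2 \<le> q" "q \<le> 1" using m m' by (auto simp: p_def q_def field_simps)
    have "p \<noteq> q" using ne m m' by (auto simp: p_def q_def field_simps)
    have "- 2 * p\<^sup>2 + 6 * p - 5 + 1 / p = - 2 * q\<^sup>2 + 6 * q - 5 + 1 / q"
      using mu_cubic_root_value[of m y] mu_cubic_root_value[of m' y] m m' by (simp add: p_def q_def)
    then have "(- 2 * p\<^sup>2 + 6 * p - 5 + 1 / p) * (p * q) = (- 2 * q\<^sup>2 + 6 * q - 5 + 1 / q) * (p * q)"
      by simp
    moreover have "1 / p * (p * q) = q" "1 / q * (p * q) = p" using pq by auto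
    ultimately have "(- 2 * p\<^sup>2 + 6 * p - 5) * (p * q) + q = (- 2 * q\<^sup>2 + 6 * q - 5) * (p * q) + p"
      by (simp only: distrib_right)
    \<comment> \<open>The difference of the two values, with denominators cleared, splits off the
      factor \<open>p - q\<close>; the cofactor is then shown to be nonzero.\<close>
    then have "(p - q) * (6 * p * q - 2 * p * q * (p + q) - 1) = 0"
      by algebra
    then have eq0: "6 * p * q - 2 * p * q * (p + q) - 1 = 0" using \<open>p \<noteq> q\<close> by simp
    \<comment> \<open>The cofactor vanishes at \<open>p = q = 1/2\<close>. Shifting the origin there
      makes its sign visible: \<open>(a + b)^2 \<le> a + b\<close> since
      \<open>a + b \<le> 1\<close>, and \<open>a + b > 0\<close> since
      \<open>a \<noteq> b\<close>.\<close>
    define a b where "a = p - 1/2" and "b = q - 1/2"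
    have ab: "0 \<le> a" "a \<le> 1/2" "0 \<le> b" "b \<le> 1/2" "a \<noteq> b" "p = a + 1/2" "q = b + 1/2"
      using pq \<open>p \<noteq> q\<close> by (auto simp: a_def b_def)
    have z: "3 / 2 * (a + b) - (a + b)\<^sup>2 + a * b * (4 - 2 * (a + b)) = 0"
      using eq0 unfolding ab(6,7) by (simp add: power2_eq_square field_simps)
    have "a + b > 0" using ab by linarith
    moreover have "(a + b)\<^sup>2 \<le> a + b" using ab by (simp add: power2_eq_square mult_left_le)
    moreover have "a * b * (4 - 2 * (a + b)) \<ge> 0" using ab by (intro mult_nonneg_nonneg) auto
    moreover have "3 / 2 * s - x + w \<noteq> 0" if "s > 0" "x \<le> s" "w \<ge> 0" for s x w :: real
      using that by linarith
    ultimately show False using z by blast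
  qed
  ultimately show ?thesis by (metis atLeastAtMost_iff)
qed

text \<open>Takes slope \<open>- k\<close> and splits \<open>2 * k = m - (m - 2 * k)\<close>. The
  part with \<open>m\<close> integrates to a multiple of \<open>psi\<close>; the nonnegative
  multiplier \<open>m - 2 * k\<close> is spent on the constraint, leaving a term that depends on
  \<open>v\<close> alone.\<close>

lemma section_energy_ge_tilted:
  assumes C: "is_copula C" and v: "0 < v" "v < 1"
    and k: "2 * k \<le> m" and d: "- d \<le> C v v - v\<^sup>2"
  shows "section_energy C v \<ge> v\<^sup>2 - m * (C v v - v\<^sup>2) + (- (m - 2 * k) * d - k\<^sup>2 * (v * (1 - v)))"
proof -
  have "(m - 2 * k) * (- d) \<le> (m - 2 * k) * (C v v - v\<^sup>2)"
    by (rule mult_left_mono) (use k d in auto)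
  then show ?thesis
    using section_energy_ge[OF C v, of "- k"] by (simp add: algebra_simps)
qed

lemma integral_section_energy_ge:
  assumes C: "is_copula C" and ab: "0 \<le> a" "a \<le> b" "b \<le> 1"
    and g: "(g has_integral I) {a..b}"
    and le: "\<And>v. a < v \<Longrightarrow> v < b \<Longrightarrow>
      v\<^sup>2 - m * (C v v - v\<^sup>2) + g v \<le> section_energy C v"
  shows "integral {a..b} (\<lambda>v. v\<^sup>2 - m * (C v v - v\<^sup>2)) + I \<le> integral {a..b} (section_energy C)"
proof -
  have "(\<lambda>v. v\<^sup>2 - m * (C v v - v\<^sup>2)) integrable_on {a..b}"
    using continuous_on_diagonal[OF C] ab
    by (intro integrable_continuous_real continuous_intros) (auto elim: continuous_on_subset)
  from has_integral_add[OF integrable_integral[OF this] g]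
  have 1: "((\<lambda>v. v\<^sup>2 - m * (C v v - v\<^sup>2) + g v) has_integral
      integral {a..b} (\<lambda>v. v\<^sup>2 - m * (C v v - v\<^sup>2)) + I) {a<..<b}"
    by (simp only: has_integral_Icc_iff_Ioo)
  have "section_energy C integrable_on {a..b}"
    by (rule integrable_subinterval_real[of _ 0 1]) (use section_energy_integral[OF C] ab in auto)
  from integrable_integral[OF this]
  have 2: "(section_energy C has_integral integral {a..b} (section_energy C)) {a<..<b}"
    by (simp only: has_integral_Icc_iff_Ioo)
  show ?thesis by (rule has_integral_le[OF 1 2]) (use le in auto)
qed

text \<open>Pointwise minimisation of \<open>xi + m * psi\<close>. On \<open>[0, s]\<close> and
  \<open>[1 - s, 1]\<close> the diagonal constraint binds, with \<open>k = v / (1 - v)\<close> and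
  \<open>k = (1 - v) / v\<close>; in the middle it is slack, with \<open>k = m / 2\<close>. The
  regimes meet where \<open>v / (1 - v) = m / 2\<close>, which is \<open>v = s\<close>.\<close>

lemma tilted_xi_ge:
  assumes C: "is_copula C" and m: "0 \<le> m" "m \<le> 2"
  defines "s \<equiv> m / (2 + m)"
  shows "xi C + m * psi C \<ge> 12 * (- (s + s^2 / 2 + s^3 / 3) - ln (1 - s) - m * s^3 / 3)
           - m^2 / 4 * (1 - 6 * s^2 + 4 * s^3)"
proof -
  let ?t = "\<lambda>v. v\<^sup>2 - m * (C v v - v\<^sup>2)"
  define I where "I = - (s + s^2 / 2 + s^3 / 3) - ln (1 - s) - m * s^3 / 3"
  have s: "0 \<le> s" "s \<le> 1/2" "s < 1" using m by (auto simp: s_def field_simps)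
  have diag: "C v v - v\<^sup>2 \<ge> - (v\<^sup>2)" "C v v - v\<^sup>2 \<ge> - ((1 - v)\<^sup>2)" if "0 \<le> v" "v \<le> 1" for v
    using diagonal_bounds[OF C that] by (auto simp: power2_eq_square algebra_simps)
  have slope: "2 * (v / (1 - v)) \<le> m" if "0 \<le> v" "v \<le> s" for v
  proof -
    have "v * (2 + m) \<le> m" using that m by (simp add: s_def field_simps)
    then have "2 * v \<le> m * (1 - v)" by (simp add: algebra_simps)
    then show ?thesis using that s by (simp add: field_simps)
  qed

  \<comment> \<open>The integrand is the remainder of the tilted bound for
    \<open>k = v / (1 - v)\<close> and \<open>d = v^2\<close>. Division gives
    \<open>v^3 / (1 - v) = - (1 + v + v^2) + 1 / (1 - v)\<close>, the source of the logarithm in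
    \<open>Xi\<close>.\<close>
  have "((\<lambda>v. v^3 / (1 - v) - m * v\<^sup>2) has_integral
      I - (- (0 + 0^2 / 2 + 0^3 / 3) - ln (1 - 0) - m * 0^3 / 3)) {0..s}"
    unfolding I_def
  proof (rule fundamental_theorem_of_calculus)
    fix v assume v: "v \<in> {0..s}"
    then have "v < 1" using s by auto
    have "((\<lambda>v. - (v + v^2 / 2 + v^3 / 3) - ln (1 - v) - m * v^3 / 3) has_real_derivative
        - (1 + v + v^2) + 1 / (1 - v) - m * v^2) (at v)"
      by (rule derivative_eq_intros refl | use \<open>v < 1\<close> in \<open>force simp: field_simps\<close>)+
    moreover have "- (1 + v + v^2) + 1 / (1 - v) - m * v^2 = v^3 / (1 - v) - m * v\<^sup>2"
      using \<open>v < 1\<close> by (simp add: field_simps power2_eq_square power3_eq_cube)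
    ultimately have "((\<lambda>v. - (v + v^2 / 2 + v^3 / 3) - ln (1 - v) - m * v^3 / 3) has_real_derivative
        v^3 / (1 - v) - m * v\<^sup>2) (at v)"
      by (simp only:)
    then show "((\<lambda>v. - (v + v^2 / 2 + v^3 / 3) - ln (1 - v) - m * v^3 / 3) has_vector_derivative
        v^3 / (1 - v) - m * v\<^sup>2) (at v within {0..s})"
      unfolding has_real_derivative_iff_has_vector_derivative[symmetric]
      by (rule has_field_derivative_at_within)
  qed (use s in auto)
  then have g1: "((\<lambda>v. v^3 / (1 - v) - m * v\<^sup>2) has_integral I) {0..s}" by simp
  \<comment> \<open>The reflection \<open>v \<mapsto> 1 - v\<close> exchanges the two boundary
    regimes, so the right one contributes the same \<open>I\<close>.\<close>
  have "(\<lambda>x. 1 - x) ` {0..s} = {1 - s..1}"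
    by (auto simp: image_iff intro: bexI[of _ "1 - _"])
  then have g3: "((\<lambda>v. (1 - v)^3 / v - m * (1 - v)\<^sup>2) has_integral I) {1 - s..1}"
    using has_integral_affinity[of _ I 0 s "-1" 1, unfolded cbox_interval, OF g1] by simp

  have g2: "((\<lambda>v. - (m^2 / 4) * (v * (1 - v))) has_integral
      - (m^2 / 4) * (((1 - s)^2 / 2 - (1 - s)^3 / 3) - (s^2 / 2 - s^3 / 3))) {s..1 - s}"
  proof (rule has_integral_mult_right, rule fundamental_theorem_of_calculus)
    show "((\<lambda>v. v^2 / 2 - v^3 / 3) has_vector_derivative v * (1 - v)) (at v within {s..1 - s})" for v
      by (auto intro!: derivative_eq_intros simp: power2_eq_square algebra_simps
          simp flip: has_real_derivative_iff_has_vector_derivative)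
  qed (use s in auto)

  have tilt: "- (m - 2 * (a / b)) * a\<^sup>2 - (a / b)\<^sup>2 * (a * b) = a^3 / b - m * a\<^sup>2" if "b > 0" for a b
    using that by (simp add: field_simps power2_eq_square power3_eq_cube)
  have e1: "integral {0..s} ?t + I \<le> integral {0..s} (section_energy C)"
  proof (rule integral_section_energy_ge[OF C _ _ _ g1])
    fix v assume v: "0 < v" "v < s"
    then have "v < 1" using s by simp
    have "- (m - 2 * (v / (1 - v))) * v\<^sup>2 - (v / (1 - v))\<^sup>2 * (v * (1 - v)) = v^3 / (1 - v) - m * v\<^sup>2"
      using tilt[of "1 - v" v] \<open>v < 1\<close> by simp
    then show "v\<^sup>2 - m * (C v v - v\<^sup>2) + (v^3 / (1 - v) - m * v\<^sup>2) \<le> section_energy C v"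
      using section_energy_ge_tilted[OF C \<open>0 < v\<close> \<open>v < 1\<close> slope diag(1), of v] v \<open>v < 1\<close> by simp
  qed (use s in auto)
  have e2: "integral {s..1 - s} ?t + - (m^2 / 4) * (((1 - s)^2 / 2 - (1 - s)^3 / 3) - (s^2 / 2 - s^3 / 3))
      \<le> integral {s..1 - s} (section_energy C)"
  proof (rule integral_section_energy_ge[OF C _ _ _ g2])
    fix v assume v: "s < v" "v < 1 - s"
    then have "0 < v" "v < 1" using s by auto
    \<comment> \<open>With \<open>k = m / 2\<close> the multiplier \<open>m - 2 * k\<close> of the
      constraint vanishes.\<close>
    from section_energy_ge_tilted[OF C this, of "m / 2" m "v\<^sup>2"] diag(1)[of v] \<open>0 < v\<close> \<open>v < 1\<close>
    show "v\<^sup>2 - m * (C v v - v\<^sup>2) + - (m^2 / 4) * (v * (1 - v)) \<le> section_energy C v"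
      by (simp add: power_divide)
  qed (use s in auto)
  have e3: "integral {1 - s..1} ?t + I \<le> integral {1 - s..1} (section_energy C)"
  proof (rule integral_section_energy_ge[OF C _ _ _ g3])
    fix v assume v: "1 - s < v" "v < 1"
    then have "0 < v" using s by simp
    have "- (m - 2 * ((1 - v) / v)) * (1 - v)\<^sup>2 - ((1 - v) / v)\<^sup>2 * (v * (1 - v))
        = (1 - v)^3 / v - m * (1 - v)\<^sup>2"
      using tilt[of v "1 - v"] \<open>0 < v\<close> by (simp add: mult.commute)
    moreover have "2 * ((1 - v) / v) \<le> m" using slope[of "1 - v"] v by simp
    ultimately show "v\<^sup>2 - m * (C v v - v\<^sup>2) + ((1 - v)^3 / v - m * (1 - v)\<^sup>2) \<le> section_energy C v"
      using section_energy_ge_tilted[where k = "(1 - v) / v", OF C \<open>0 < v\<close> \<open>v < 1\<close> _ diag(2), of m] v \<open>0 < v\<close>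
      by simp
  qed (use s in auto)

  have split: "integral {0..1} f = integral {0..s} f + integral {s..1 - s} f + integral {1 - s..1} f"
    if f: "f integrable_on {0..1}" for f :: "real \<Rightarrow> real"
  proof -
    have f': "f integrable_on {0..1 - s}" by (rule integrable_subinterval_real[OF f]) (use s in auto)
    show ?thesis
      using Henstock_Kurzweil_Integration.integral_combine[OF _ _ f, of "1 - s"]
        Henstock_Kurzweil_Integration.integral_combine[OF _ _ f', of s] s by simp
  qed
  have t: "(?t has_integral 1/3 - m * ((psi C + 2) / 6 - 1/3)) {0..1}"
    by (intro has_integral_diff has_integral_mult_right
        has_integral_polynomial_01 diagonal_has_integral[OF C])
  have "integral {0..1} ?t + (2 * I - (m^2 / 4) * (((1 - s)^2 / 2 - (1 - s)^3 / 3) - (s^2 / 2 - s^3 / 3)))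
      \<le> integral {0..1} (section_energy C)"
    using e1 e2 e3 split[of ?t] split[of "section_energy C"] t section_energy_integral[OF C]
    by (simp add: has_integral_iff)
  moreover have "integral {0..1} ?t = 1/3 - m * ((psi C + 2) / 6 - 1/3)"
    "integral {0..1} (section_energy C) = energy C"
    using t section_energy_integral[OF C] by (auto intro: integral_unique)
  moreover have "((1 - s)^2 / 2 - (1 - s)^3 / 3) - (s^2 / 2 - s^3 / 3) = (1 - 6 * s^2 + 4 * s^3) / 6"
    by (simp add: power2_eq_square power3_eq_cube field_simps)
  ultimately have "1/3 - m * ((psi C + 2) / 6 - 1/3) + (2 * I - m^2 / 4 * ((1 - 6 * s^2 + 4 * s^3) / 6))
      \<le> energy C"
    by simp
  then show ?thesis
    unfolding xi_eq_energy[OF C] I_def[symmetric] by (simp add: field_simps)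
qed

text \<open>With \<open>v = 2 / (2 + m)\<close> one has \<open>s = 1 - v\<close> and
  \<open>m = 2 / v - 2\<close>. Inserting the value of \<open>y\<close> at the root, the logarithms
  agree and the rest is a rational identity in \<open>v\<close>.\<close>

lemma tilted_constant_eq_Xi:
  assumes m: "0 \<le> m" and root: "mu_cubic y m = 0"
  defines "s \<equiv> m / (2 + m)"
  shows "12 * (- (s + s^2 / 2 + s^3 / 3) - ln (1 - s) - m * s^3 / 3)
           - m^2 / 4 * (1 - 6 * s^2 + 4 * s^3) = Xi m + m * y"
proof -
  define v where "v = 2 / (2 + m)"
  have v: "v > 0" using m by (simp add: v_def)
  have s: "s = 1 - v" using m by (simp add: s_def v_def field_simps)
  have mv: "m = 2 / v - 2" using m by (simp add: v_def field_simps)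
  have y: "y = - 2 * v\<^sup>2 + 6 * v - 5 + 1 / v"
    using mu_cubic_root_value[OF m root] by (simp add: v_def)
  have Xi: "Xi m = - 4 * v^2 + 20 * v - 17 + 2 / v - 1 / v^2 - 12 * ln v"
    by (simp only: Xi_def Let_def v_def)
  have "12 * (- (s + s^2 / 2 + s^3 / 3) - m * s^3 / 3) - m^2 / 4 * (1 - 6 * s^2 + 4 * s^3)
      = - 4 * v^2 + 20 * v - 17 + 2 / v - 1 / v^2 + m * y"
    unfolding y s mv using v by (simp add: field_simps power2_eq_square power3_eq_cube)
  then show ?thesis unfolding Xi s by simp
qed

text \<open>Every tilt \<open>m\<close> in \<open>[0, 2]\<close> bounds
  \<open>xi C + m * psi C\<close> from below. At the root of the cubic for \<open>y = psi C\<close>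
  the bound reads \<open>Xi m + m * psi C\<close>, and the terms with \<open>psi C\<close>
  cancel.\<close>

lemma xi_ge_Xi:
  assumes C: "is_copula C" and neg: "psi C \<le> 0"
  shows "Xi (mu (psi C)) \<le> xi C"
proof -
  have "\<exists>!m. m \<in> {0..2} \<and> mu_cubic (psi C) m = 0"
    by (rule mu_cubic_unique_root[OF psi_bounds(1)[OF C] neg])
  from theI'[OF this] have m: "0 \<le> mu (psi C)" "mu (psi C) \<le> 2" "mu_cubic (psi C) (mu (psi C)) = 0"
    by (auto simp: mu_def)
  show ?thesis
    using tilted_xi_ge[OF C m(1,2)] tilted_constant_eq_Xi[OF m(1,3)] by simp
qed

section \<open>Convexity\<close>

text \<open>The ordinal sum of the upper Frechet bound on \<open>[0, a]\<close> and the lower one on \<open>[a, 1]\<close>: the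
  second variable is \<open>u\<close> for \<open>u \<le> a\<close> and \<open>1 + a - u\<close> afterwards.\<close>
definition frechet_sum :: "real \<Rightarrow> real \<Rightarrow> real \<Rightarrow> real" where
  "frechet_sum a u v = min u (min v a) + max 0 (u + max v a - 1 - a)"

text \<open>Each summand is 2-increasing in \<open>u\<close> and a monotone function of
  \<open>v\<close>, namely \<open>min v a\<close> or \<open>max v a\<close>, so the rectangle
  inequality carries over to the sum.\<close>

lemma is_copula_frechet_sum:
  assumes a: "0 \<le> a" "a \<le> 1"
  shows "is_copula (frechet_sum a)"
  unfolding is_copula_def
proof (intro conjI ballI allI impI)
  fix u :: real assume "u \<in> {0..1}"
  then show "frechet_sum a u 0 = 0" "frechet_sum a 0 u = 0" "frechet_sum a u 1 = u" "frechet_sum a 1 u = u"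
    using a by (auto simp: frechet_sum_def min_def max_def)
next
  fix u1 u2 v1 v2 :: real
  assume *: "0 \<le> u1 \<and> u1 \<le> u2 \<and> u2 \<le> 1 \<and> 0 \<le> v1 \<and> v1 \<le> v2 \<and> v2 \<le> 1"
  have 1: "min x2 y2 - min x2 y1 - min x1 y2 + min x1 y1 \<ge> 0"
    if "x1 \<le> x2" "y1 \<le> y2" for x1 x2 y1 y2 :: real
    using that by (auto simp: min_def)
  have 2: "max 0 (x2 + y2 - 1 - a) - max 0 (x2 + y1 - 1 - a) - max 0 (x1 + y2 - 1 - a)
      + max 0 (x1 + y1 - 1 - a) \<ge> 0"
    if "x1 \<le> x2" "y1 \<le> y2" for x1 x2 y1 y2 :: real
    using that by (auto simp: max_def)
  have add: "0 \<le> (p + p') - (q + q') - (r + r') + (w + w')"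
    if "0 \<le> p - q - r + w" "0 \<le> p' - q' - r' + w'" for p q r w p' q' r' w' :: real
    using that by linarith
  have "u1 \<le> u2" "min v1 a \<le> min v2 a" "max v1 a \<le> max v2 a" using * by auto
  then show "0 \<le> frechet_sum a u2 v2 - frechet_sum a u2 v1 - frechet_sum a u1 v2 + frechet_sum a u1 v1"
    unfolding frechet_sum_def by (intro add 1 2)
qed

text \<open>In \<open>u\<close> the function is piecewise linear with slopes 1, 0, 1;
  \<open>v \<le> 1\<close> puts the two breakpoints in order.\<close>

lemma frechet_sum_derivative:
  assumes "u \<noteq> min v a" "u \<noteq> 1 + a - max v a" and v: "v \<le> 1"
  shows "\<exists>d\<in>{0,1}. ((\<lambda>t. frechet_sum a t v) has_real_derivative d) (at u)"
proof -
  have le: "min v a \<le> 1 + a - max v a" using v by auto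
  consider "u < min v a" | "min v a < u" "u < 1 + a - max v a" | "u > 1 + a - max v a"
    using assms by linarith
  then show ?thesis
  proof cases
    case 1
    have "eventually (\<lambda>t. t \<in> {..<min v a}) (nhds u)"
      by (rule eventually_nhds_in_open) (use 1 in auto)
    then have "eventually (\<lambda>t. frechet_sum a t v = t) (nhds u)"
      by eventually_elim (use le in \<open>auto simp: frechet_sum_def\<close>)
    from DERIV_cong_ev[OF refl this refl] show ?thesis by (auto intro!: derivative_eq_intros)
  next
    case 2
    have "eventually (\<lambda>t. t \<in> {min v a<..<1 + a - max v a}) (nhds u)"
      by (rule eventually_nhds_in_open) (use 2 in auto)
    then have "eventually (\<lambda>t. frechet_sum a t v = min v a) (nhds u)"
      by eventually_elim (auto simp: frechet_sum_def)
    from DERIV_cong_ev[OF refl this refl] show ?thesis by auto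
  next
    case 3
    have "eventually (\<lambda>t. t \<in> {1 + a - max v a<..}) (nhds u)"
      by (rule eventually_nhds_in_open) (use 3 in auto)
    then have "eventually (\<lambda>t. frechet_sum a t v = min v a + (t + max v a - 1 - a)) (nhds u)"
      by eventually_elim (use le in \<open>auto simp: frechet_sum_def\<close>)
    from DERIV_cong_ev[OF refl this refl] show ?thesis by (auto intro!: derivative_eq_intros)
  qed
qed

text \<open>The derivative is 0 or 1 almost everywhere, hence equal to its square, and each section
  energy attains its upper bound \<open>v\<close>.\<close>

lemma xi_frechet_sum:
  assumes a: "0 \<le> a" "a \<le> 1"
  shows "xi (frechet_sum a) = 1"
proof -
  let ?C = "frechet_sum a"
  note C = is_copula_frechet_sum[OF a]
  have S: "section_energy ?C v = v" if v: "0 < v" "v < 1" for v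
  proof -
    have "AE u in lborel. (square_d1 ?C (u, v))\<^sup>2 = square_d1 ?C (u, v)"
      using AE_lborel_singleton[of "min v a"] AE_lborel_singleton[of "1 + a - max v a"]
    proof eventually_elim
      case (elim u)
      then obtain d where "d \<in> {0, 1}" "((\<lambda>t. ?C t v) has_real_derivative d) (at u)"
        using frechet_sum_derivative[of u v a] v by auto
      then show ?case by (auto simp: square_d1_def d1_eq)
    qed
    then have "AE u in lborel. u \<in> {0..1} \<longrightarrow> (square_d1 ?C (u, v))\<^sup>2 = square_d1 ?C (u, v)"
      by eventually_elim auto
    from has_integral_AE[OF this] section_energy_has_integral[OF C, of v]
    have "((\<lambda>u. square_d1 ?C (u, v)) has_integral section_energy ?C v) {0..1}" by blast
    moreover have "((\<lambda>u. square_d1 ?C (u, v)) has_integral ext ?C 1 v - ext ?C 0 v) {0..1}"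
      by (rule has_integral_square_d1[OF C v]) simp
    ultimately have "section_energy ?C v = ext ?C 1 v - ext ?C 0 v" by (rule has_integral_unique)
    then show ?thesis using v by (simp add: copula_boundary[OF C])
  qed
  have "((\<lambda>v. v) has_integral (1/2::real)) {0<..<1}"
    using has_integral_polynomial_01(3) by (simp only: has_integral_Icc_iff_Ioo)
  then have "(section_energy ?C has_integral 1/2) {0<..<1}"
    by (rule has_integral_eq[rotated]) (simp add: S)
  then have "(section_energy ?C has_integral 1/2) {0..1}"
    by (simp only: has_integral_Icc_iff_Ioo)
  with section_energy_integral[OF C] have "energy ?C = 1/2" by (rule has_integral_unique)
  then show ?thesis by (simp add: xi_eq_energy[OF C])
qed

text \<open>The parameter \<open>a\<close> moves from the lower Frechet bound (\<open>a = 0\<close>,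
  \<open>psi = - 1/2\<close>) to the upper one (\<open>a = 1\<close>, \<open>psi = 1\<close>). Since
  \<open>psi\<close> depends continuously on \<open>a\<close>, all values in between occur.\<close>

lemma ex_copula_xi_1:
  assumes y: "- 1/2 \<le> y" "y \<le> 1"
  shows "\<exists>E. is_copula E \<and> xi E = 1 \<and> psi E = y"
proof -
  have 0: "psi (frechet_sum 0) = - 1/2"
  proof -
    have "((\<lambda>u. 0) has_integral (0::real)) {0..1/2::real}" by simp
    then have 1: "((\<lambda>u. frechet_sum 0 u u) has_integral 0) {0..1/2}"
      by (rule has_integral_eq[rotated]) (auto simp: frechet_sum_def)
    have "((\<lambda>u. 2 * u - 1) has_integral (1^2 - 1) - ((1/2)^2 - 1/2)) {1/2..1::real}"
      by (rule fundamental_theorem_of_calculus)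
         (auto intro!: derivative_eq_intros simp flip: has_real_derivative_iff_has_vector_derivative)
    then have "((\<lambda>u. frechet_sum 0 u u) has_integral (1^2 - 1) - ((1/2)^2 - 1/2)) {1/2..1}"
      by (rule has_integral_eq[rotated]) (auto simp: frechet_sum_def)
    from has_integral_combine[OF _ _ 1 this]
    have "((\<lambda>u. frechet_sum 0 u u) has_integral 1/4) {0..1}" by (simp add: power2_eq_square)
    then show ?thesis by (simp add: psi_def integral_unique)
  qed
  have 1: "psi (frechet_sum 1) = 1"
  proof -
    have "((\<lambda>u. frechet_sum 1 u u) has_integral 1/2) {0..1}"
      using has_integral_polynomial_01(3) by (rule has_integral_eq[rotated]) (auto simp: frechet_sum_def)
    then show ?thesis by (simp add: psi_def integral_unique)
  qed
  have "continuous_on {0..1} (\<lambda>a. integral (cbox 0 1) (\<lambda>u. frechet_sum a u u))"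
  proof (rule integral_continuous_on_param)
    show "continuous_on ({0..1} \<times> cbox 0 1) (\<lambda>(a, u). frechet_sum a u u)"
      unfolding frechet_sum_def case_prod_beta' by (intro continuous_intros)
  qed
  then have "continuous_on {0..1} (\<lambda>a. psi (frechet_sum a))"
    unfolding psi_def cbox_interval by (intro continuous_intros)
  then obtain a where "0 \<le> a" "a \<le> 1" "psi (frechet_sum a) = y"
    using IVT'[of "\<lambda>a. psi (frechet_sum a)" 0 y 1] y 0 1 by auto
  then show ?thesis using is_copula_frechet_sum xi_frechet_sum by blast
qed

section \<open>Mixtures of copulas\<close>

definition mixture :: "real \<Rightarrow> (real \<Rightarrow> real \<Rightarrow> real) \<Rightarrow> (real \<Rightarrow> real \<Rightarrow> real) \<Rightarrow> real \<Rightarrow> real \<Rightarrow> real" where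
  "mixture s C E u v = s * C u v + (1 - s) * E u v"

lemma is_copula_mixture:
  assumes C: "is_copula C" and E: "is_copula E" and s: "0 \<le> s" "s \<le> 1"
  shows "is_copula (mixture s C E)"
  unfolding is_copula_def
proof (intro conjI ballI allI impI)
  fix u :: real assume "u \<in> {0..1}"
  then show "mixture s C E u 0 = 0" "mixture s C E 0 u = 0" "mixture s C E u 1 = u" "mixture s C E 1 u = u"
    by (auto simp: mixture_def copula_boundary[OF C] copula_boundary[OF E] algebra_simps)
next
  fix u1 u2 v1 v2 :: real
  assume *: "0 \<le> u1 \<and> u1 \<le> u2 \<and> u2 \<le> 1 \<and> 0 \<le> v1 \<and> v1 \<le> v2 \<and> v2 \<le> 1"
  have "C u2 v2 - C u2 v1 - C u1 v2 + C u1 v1 \<ge> 0" "E u2 v2 - E u2 v1 - E u1 v2 + E u1 v1 \<ge> 0"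
    using copula_2increasing[OF C] copula_2increasing[OF E] * by blast+
  then have "0 \<le> s * (C u2 v2 - C u2 v1 - C u1 v2 + C u1 v1)
      + (1 - s) * (E u2 v2 - E u2 v1 - E u1 v2 + E u1 v1)"
    using s by (metis add_nonneg_nonneg mult_nonneg_nonneg diff_ge_0_iff_ge)
  then show "0 \<le> mixture s C E u2 v2 - mixture s C E u2 v1 - mixture s C E u1 v2 + mixture s C E u1 v1"
    by (simp add: mixture_def algebra_simps)
qed

lemma psi_mixture:
  assumes C: "is_copula C" and E: "is_copula E"
  shows "psi (mixture s C E) = s * psi C + (1 - s) * psi E"
proof -
  have "((\<lambda>v. s * C v v + (1 - s) * E v v) has_integral
      s * ((psi C + 2) / 6) + (1 - s) * ((psi E + 2) / 6)) {0..1}"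
    by (intro has_integral_add has_integral_mult_right diagonal_has_integral C E)
  then show ?thesis
    unfolding psi_def[of "mixture s C E"] mixture_def by (simp add: integral_unique field_simps)
qed

text \<open>Almost everywhere all three derivatives exist and the derivative of the mixture is the
  mixture of the derivatives; the square is then expanded. As a polynomial in \<open>s\<close> the
  result is continuous.\<close>

lemma energy_mixture:
  assumes C: "is_copula C" and E: "is_copula E" and s: "0 \<le> s" "s \<le> 1"
  shows "energy (mixture s C E) = s\<^sup>2 * energy C
           + 2 * s * (1 - s) * (LINT z|lborel. square_d1 C z * square_d1 E z) + (1 - s)\<^sup>2 * energy E"
proof -
  note M = is_copula_mixture[OF C E s]
  have "AE z in lborel. (square_d1 (mixture s C E) z)\<^sup>2 = s\<^sup>2 * (square_d1 C z)\<^sup>2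
           + 2 * s * (1 - s) * (square_d1 C z * square_d1 E z) + (1 - s)\<^sup>2 * (square_d1 E z)\<^sup>2"
    using AE_square_has_derivative[OF C] AE_square_has_derivative[OF E] AE_square_has_derivative[OF M]
  proof eventually_elim
    case (elim z)
    show ?case
    proof (cases "z \<in> {0<..<1} \<times> {0<..<1}")
      case True
      have "((\<lambda>t. s * ext C t (snd z) + (1 - s) * ext E t (snd z)) has_real_derivative
          s * square_d1 C z + (1 - s) * square_d1 E z) (at (fst z))"
        using elim True by (auto intro!: derivative_eq_intros)
      moreover have "((\<lambda>t. s * ext C t (snd z) + (1 - s) * ext E t (snd z)) has_real_derivative
          square_d1 (mixture s C E) z) (at (fst z))"
        using elim(3) True by (simp add: ext_def mixture_def)
      ultimately have eq: "square_d1 (mixture s C E) z = s * square_d1 C z + (1 - s) * square_d1 E z"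
        by (rule DERIV_unique[symmetric])
      show ?thesis unfolding eq by algebra
    qed (simp add: square_d1_def)
  qed
  then have "energy (mixture s C E) = (LINT z|lborel. s\<^sup>2 * (square_d1 C z)\<^sup>2
           + 2 * s * (1 - s) * (square_d1 C z * square_d1 E z) + (1 - s)\<^sup>2 * (square_d1 E z)\<^sup>2)"
    unfolding energy_def
    using square_d1_measurable[OF C] square_d1_measurable[OF E] square_d1_measurable[OF M]
    by (intro integral_cong_AE) simp_all
  also have "\<dots> = s\<^sup>2 * energy C
           + 2 * s * (1 - s) * (LINT z|lborel. square_d1 C z * square_d1 E z) + (1 - s)\<^sup>2 * energy E"
    using integrable_square_d1_power2[OF C] integrable_square_d1_power2[OF E]
      integrable_square_d1_mult[OF C E] by (simp add: energy_def)
  finally show ?thesis .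
qed

text \<open>Convexity of a quadratic form: the mixed term is controlled by the nonnegative integral
  of \<open>(square_d1 C z - square_d1 E z)^2\<close>.\<close>

lemma xi_mixture_le:
  assumes C: "is_copula C" and E: "is_copula E" and s: "0 \<le> s" "s \<le> 1"
  shows "xi (mixture s C E) \<le> s * xi C + (1 - s) * xi E"
proof -
  define b where "b = (LINT z|lborel. square_d1 C z * square_d1 E z)"
  have "0 \<le> (LINT z|lborel. (square_d1 C z - square_d1 E z)\<^sup>2)" by simp
  also have "\<dots> = (LINT z|lborel. (square_d1 C z)\<^sup>2 + (square_d1 E z)\<^sup>2 - 2 * (square_d1 C z * square_d1 E z))"
    by (simp add: power2_diff mult.assoc)
  also have "\<dots> = energy C + energy E - 2 * b"
    using integrable_square_d1_power2[OF C] integrable_square_d1_power2[OF E]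
      integrable_square_d1_mult[OF C E] by (simp add: energy_def b_def)
  finally have "s * (1 - s) * (2 * b) \<le> s * (1 - s) * (energy C + energy E)"
    using s by (intro mult_left_mono) auto
  then have "energy (mixture s C E) \<le> s * energy C + (1 - s) * energy E"
    unfolding energy_mixture[OF C E s] b_def[symmetric] by (simp add: power2_eq_square algebra_simps)
  then show ?thesis
    by (simp add: xi_eq_energy[OF C] xi_eq_energy[OF E] xi_eq_energy[OF is_copula_mixture[OF C E s]]
        algebra_simps)
qed

text \<open>Mixing with a copula of the same \<open>\<psi>\<close> and maximal \<open>\<xi>\<close> raises \<open>\<xi>\<close> continuously and keeps \<open>\<psi>\<close>.\<close>
lemma region_right_closed:
  assumes C: "is_copula C" and x: "xi C \<le> x" "x \<le> 1"
  shows "(x, psi C) \<in> region"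
proof -
  obtain E where E: "is_copula E" "xi E = 1" "psi E = psi C"
    using ex_copula_xi_1 psi_bounds[OF C] by metis
  define b where "b = (LINT z|lborel. square_d1 C z * square_d1 E z)"
  define p where "p = (\<lambda>s. 6 * (s\<^sup>2 * energy C + 2 * s * (1 - s) * b + (1 - s)\<^sup>2 * energy E) - 2)"
  have p: "p s = xi (mixture s C E)" if "0 \<le> s" "s \<le> 1" for s
    unfolding p_def b_def xi_eq_energy[OF is_copula_mixture[OF C E(1) that]] energy_mixture[OF C E(1) that]
    by simp
  \<comment> \<open>At the ends \<open>p 1 = xi C\<close> and \<open>p 0 = xi E = 1\<close>, so the
    intermediate value theorem reaches \<open>x\<close>.\<close>
  have "p 1 \<le> x" "x \<le> p 0"
    using x E(2) xi_eq_energy[OF C] xi_eq_energy[OF E(1)] by (auto simp: p_def)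
  moreover have "continuous_on {0..1} p" unfolding p_def by (intro continuous_intros)
  ultimately obtain s where s: "0 \<le> s" "s \<le> 1" "p s = x"
    using IVT2'[of p 1 x 0] by auto
  have "psi (mixture s C E) = psi C" by (simp add: psi_mixture[OF C E(1)] E(3) algebra_simps)
  with p[OF s(1,2)] s(3) is_copula_mixture[OF C E(1) s(1,2)] show ?thesis
    unfolding region_def mem_Collect_eq by (intro exI[of _ "mixture s C E"]) simp
qed

text \<open>The mixture has exactly the required \<open>psi\<close> and at most the required
  \<open>xi\<close>, which is itself at most 1; moving right inside the region closes the
  gap.\<close>

lemma convex_region: "convex region"
proof (rule convexI)
  fix p q :: "real \<times> real" and s t :: real
  assume "p \<in> region" "q \<in> region" and st: "0 \<le> s" "0 \<le> t" "s + t = 1"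
  then obtain C E where C: "is_copula C" "p = (xi C, psi C)" and E: "is_copula E" "q = (xi E, psi E)"
    by (auto simp: region_def)
  have t: "t = 1 - s" "s \<le> 1" using st by auto
  have "s * xi C + t * xi E \<le> s * 1 + t * 1"
    using st xi_le_1[OF C(1)] xi_le_1[OF E(1)] by (intro add_mono mult_left_mono) auto
  then have "(s * xi C + t * xi E, psi (mixture s C E)) \<in> region"
    using is_copula_mixture[OF C(1) E(1) st(1) t(2)] xi_mixture_le[OF C(1) E(1) st(1) t(2)] st(3)
    by (intro region_right_closed) (simp_all add: t(1))
  then show "s *\<^sub>R p + t *\<^sub>R q \<in> region"
    by (simp add: C(2) E(2) psi_mixture[OF C(1) E(1)] t(1))
qed

section \<open>Closedness\<close>

text \<open>Approximates \<open>energy\<close> without derivatives: for fixed \<open>h\<close> only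
  values of \<open>C\<close> enter, which makes it continuous under pointwise convergence.\<close>

definition quotient_energy :: "real \<Rightarrow> (real \<Rightarrow> real \<Rightarrow> real) \<Rightarrow> real" where
  "quotient_energy h C = (LINT z|lborel. (indicator ({0<..<1} \<times> {0<..<1}) z *
     difference_quotient (\<lambda>t. ext C t (snd z)) (fst z) h)\<^sup>2)"

lemma difference_quotient_ext_bounds:
  assumes "is_copula C" "h > 0"
  shows "0 \<le> difference_quotient (\<lambda>t. ext C t v) u h" "difference_quotient (\<lambda>t. ext C t v) u h \<le> 1"
  using ext_increment_fst[OF assms(1), of u "u + h" v] assms(2)
  by (auto simp: difference_quotient_def field_simps)

lemma quotient_integrand_measurable:
  assumes C: "is_copula C"
  shows "(\<lambda>z. (indicator ({0<..<1} \<times> {0<..<1}) z *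
     difference_quotient (\<lambda>t. ext C t (snd z)) (fst z) h)\<^sup>2) \<in> borel_measurable borel"
proof -
  have "{0<..<1} \<times> {0<..<1} \<in> sets (borel :: (real \<times> real) measure)"
    by (intro borel_open open_Times) auto
  then show ?thesis
    using ext_shift_measurable[OF C, of h] ext_shift_measurable[OF C, of 0]
    unfolding difference_quotient_def by simp
qed

lemma quotient_integrand_le:
  assumes C: "is_copula C" "h > 0"
  shows "\<bar>(indicator ({0<..<1} \<times> {0<..<1}) z *
     difference_quotient (\<lambda>t. ext C t (snd z)) (fst z) h)\<^sup>2\<bar> \<le> 1"
  using difference_quotient_ext_bounds[OF assms, of "snd z" "fst z"]
  by (auto simp: indicator_def power_le_one)

lemma integrable_quotient:
  assumes "is_copula C" "h > 0"
  shows "integrable lborel (\<lambda>z. (indicator ({0<..<1} \<times> {0<..<1}) z *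
     difference_quotient (\<lambda>t. ext C t (snd z)) (fst z) h)\<^sup>2)"
  by (rule integrable_bounded_on_square[where B = 1])
     (use quotient_integrand_measurable[OF assms(1)] quotient_integrand_le[OF assms] in auto)

text \<open>A difference quotient is a mean of the derivative over \<open>[u, u + h]\<close>; Jensen's inequality and
  Tonelli's theorem bound its energy by that of the derivative.\<close>
lemma nn_integral_difference_quotient_le:
  assumes C: "is_copula C" and v: "0 < v" "v < 1" and h: "h > 0"
  shows "(\<integral>\<^sup>+ u. ennreal ((difference_quotient (\<lambda>t. ext C t v) u h)\<^sup>2) \<partial>lborel)
           \<le> ennreal (section_energy C v)"
proof -
  let ?q = "\<lambda>u. difference_quotient (\<lambda>t. ext C t v) u h"
  define f where "f = (\<lambda>u. square_d1 C (u, v))"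
  have f[measurable]: "f \<in> borel_measurable borel"
    unfolding f_def by (rule section_measurable[OF C])
  have f2: "integrable lborel (\<lambda>u. (f u)\<^sup>2)"
    unfolding f_def by (rule integrable_section_power2[OF C])
  have jensen: "ennreal ((?q u)\<^sup>2) \<le> (\<integral>\<^sup>+ t. (if u \<le> t \<and> t \<le> u + h then ennreal ((f t)\<^sup>2 / h) else 0) \<partial>lborel)"
    for u
  proof -
    define K where "K = integral {u..u + h} (\<lambda>t. (f t)\<^sup>2)"
    have "(\<lambda>t. (f t)\<^sup>2) integrable_on {u..u + h}"
      using has_integral_integral_real[OF f2] integrable_on_subinterval
      by (metis integrable_on_def subset_UNIV cbox_interval)
    then have K: "((\<lambda>t. (f t)\<^sup>2) has_integral K) {u..u + h}"
      unfolding K_def by (rule integrable_integral)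
    \<comment> \<open>\<open>?p\<close> is the mean of \<open>f\<close> over
      \<open>[u, u + h]\<close>; the tangent line inequality at this level is Jensen's inequality
      for the square.\<close>
    let ?p = "?q u"
    have "((\<lambda>t. 2 * ?p * f t - ?p\<^sup>2) has_integral
        2 * ?p * (ext C (u + h) v - ext C u v) - ?p\<^sup>2 * h) {u..u + h}"
      using has_integral_const_real[of "?p\<^sup>2" u "u + h"] h unfolding f_def
      by (intro has_integral_diff has_integral_mult_right has_integral_square_d1 C v)
         (simp_all add: mult.commute)
    then have "2 * ?p * (ext C (u + h) v - ext C u v) - ?p\<^sup>2 * h \<le> K"
    proof (rule has_integral_le[OF _ K])
      show "2 * ?p * f t - ?p\<^sup>2 \<le> (f t)\<^sup>2" for t
        using zero_le_power2[of "f t - ?p"] by (simp add: power2_diff mult_ac)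
    qed
    moreover have "ext C (u + h) v - ext C u v = ?p * h" using h by (simp add: difference_quotient_def)
    ultimately have "?p\<^sup>2 \<le> K / h" using h by (simp add: power2_eq_square field_simps)
    moreover have "((\<lambda>t. (f t)\<^sup>2 / h) has_integral K / h) {u..u + h}"
      using has_integral_divide[OF K] .
    from nn_integral_has_integral_lebesgue'[OF _ this] h
    have "(\<integral>\<^sup>+ t. ennreal ((f t)\<^sup>2 / h) * indicator {u..u + h} t \<partial>lborel) = ennreal (K / h)"
      by simp
    moreover have "(\<integral>\<^sup>+ t. (if u \<le> t \<and> t \<le> u + h then ennreal ((f t)\<^sup>2 / h) else 0) \<partial>lborel)
        = (\<integral>\<^sup>+ t. ennreal ((f t)\<^sup>2 / h) * indicator {u..u + h} t \<partial>lborel)"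
      by (intro nn_integral_cong) (simp add: indicator_def)
    ultimately show ?thesis by (simp add: ennreal_leI)
  qed
  have "(\<integral>\<^sup>+ u. ennreal ((?q u)\<^sup>2) \<partial>lborel)
      \<le> (\<integral>\<^sup>+ u. (\<integral>\<^sup>+ t. (if u \<le> t \<and> t \<le> u + h then ennreal ((f t)\<^sup>2 / h) else 0) \<partial>lborel) \<partial>lborel)"
    by (intro nn_integral_mono jensen)
  also have "\<dots> = (\<integral>\<^sup>+ t. (\<integral>\<^sup>+ u. (if u \<le> t \<and> t \<le> u + h then ennreal ((f t)\<^sup>2 / h) else 0) \<partial>lborel) \<partial>lborel)"
    by (rule lborel_pair.Fubini'[symmetric]) measurable
  also have "\<dots> = (\<integral>\<^sup>+ t. ennreal ((f t)\<^sup>2) \<partial>lborel)"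
  proof (rule nn_integral_cong)
    fix t
    \<comment> \<open>For fixed \<open>t\<close> the condition confines \<open>u\<close> to
      \<open>[t - h, t]\<close>, whose length \<open>h\<close> cancels the factor
      \<open>1 / h\<close>.\<close>
    have "(\<integral>\<^sup>+ u. (if u \<le> t \<and> t \<le> u + h then ennreal ((f t)\<^sup>2 / h) else 0) \<partial>lborel)
        = (\<integral>\<^sup>+ u. ennreal ((f t)\<^sup>2 / h) * indicator {t - h..t} u \<partial>lborel)"
      by (intro nn_integral_cong) (auto simp: indicator_def)
    also have "\<dots> = ennreal ((f t)\<^sup>2 / h) * ennreal h"
      using h by (simp add: nn_integral_cmult_indicator)
    also have "\<dots> = ennreal ((f t)\<^sup>2)"
      using h by (simp flip: ennreal_mult)
    finally show "(\<integral>\<^sup>+ u. (if u \<le> t \<and> t \<le> u + h then ennreal ((f t)\<^sup>2 / h) else 0) \<partial>lborel)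
        = ennreal ((f t)\<^sup>2)" .
  qed
  also have "\<dots> = ennreal (section_energy C v)"
    using nn_integral_eq_integral[OF f2] by (simp add: section_energy_def f_def)
  finally show ?thesis .
qed

lemma quotient_energy_le:
  assumes C: "is_copula C" and h: "h > 0"
  shows "quotient_energy h C \<le> energy C"
proof -
  let ?g = "\<lambda>z. (indicator ({0<..<1} \<times> {0<..<1}) z *
     difference_quotient (\<lambda>t. ext C t (snd z)) (fst z) h)\<^sup>2 :: real"
  have i: "integrable (lborel \<Otimes>\<^sub>M lborel) (\<lambda>(u, v). ?g (u, v))"
    using integrable_quotient[OF C h] unfolding case_prod_beta' lborel_prod by simp
  have "quotient_energy h C = (LINT v|lborel. (LINT u|lborel. ?g (u, v)))"
    unfolding lborel_pair.integral_snd[OF i] unfolding quotient_energy_def case_prod_beta' lborel_prod by simp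
  also have "\<dots> \<le> (LINT v|lborel. section_energy C v)"
  proof (rule integral_mono[OF lborel_pair.integrable_snd[OF i] integrable_section_energy(1)[OF C]])
    fix v :: real
    have S0: "section_energy C v \<ge> 0" by (simp add: section_energy_def)
    show "(LINT u|lborel. ?g (u, v)) \<le> section_energy C v"
    proof (cases "0 < v \<and> v < 1")
      case True
      have m: "(\<lambda>u. ?g (u, v)) \<in> borel_measurable borel"
        by (rule measurable_compose[OF _ quotient_integrand_measurable[OF C]])
           (intro borel_measurable_continuous_onI continuous_intros)
      have "integrable lborel (\<lambda>u. ?g (u, v))"
        by (rule integrable_bounded_on_interval[where B = 1, OF m quotient_integrand_le[OF C h]]) auto
      then have "ennreal (LINT u|lborel. ?g (u, v)) = (\<integral>\<^sup>+ u. ennreal (?g (u, v)) \<partial>lborel)"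
        by (intro nn_integral_eq_integral[symmetric]) auto
      also have "\<dots> \<le> (\<integral>\<^sup>+ u. ennreal ((difference_quotient (\<lambda>t. ext C t v) u h)\<^sup>2) \<partial>lborel)"
        by (intro nn_integral_mono ennreal_leI) (auto simp: indicator_def)
      also have "\<dots> \<le> ennreal (section_energy C v)"
        using True by (intro nn_integral_difference_quotient_le C h) auto
      finally show ?thesis using S0 by (simp add: ennreal_le_iff)
    qed (use S0 in simp)
  qed
  also have "\<dots> = energy C" by (simp add: energy_eq_section[OF C])
  finally show ?thesis .
qed

lemma integrable_unit_square_indicator:
  "integrable lborel (indicator (cbox (0, 0) (1, 1)) :: real \<times> real \<Rightarrow> real)"
  by (intro integrable_real_indicator) (auto simp: emeasure_lborel_cbox_eq)

lemma quotient_integrand_le_indicator: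
  assumes C: "is_copula C" "h > 0"
  shows "norm ((indicator ({0<..<1} \<times> {0<..<1}) z *
     difference_quotient (\<lambda>t. ext C t (snd z)) (fst z) h)\<^sup>2) \<le> indicator (cbox (0, 0) (1, 1)) z"
proof (cases "z \<in> {0<..<1} \<times> {0<..<1}")
  case True
  then have "z \<in> cbox (0,0) (1,1)" by (cases z) auto
  then show ?thesis using quotient_integrand_le[OF assms, of z] by simp
qed simp

lemma quotient_energy_tendsto:
  assumes C: "is_copula C"
  shows "(\<lambda>n. quotient_energy (1 / real (Suc n)) C) \<longlonglongrightarrow> energy C"
  unfolding quotient_energy_def energy_def
proof (rule integral_dominated_convergence[where w = "indicator (cbox (0,0) (1,1))"])
  show "AE z in lborel. (\<lambda>n. (indicator ({0<..<1} \<times> {0<..<1}) z *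
     difference_quotient (\<lambda>t. ext C t (snd z)) (fst z) (1 / real (Suc n)))\<^sup>2) \<longlonglongrightarrow> (square_d1 C z)\<^sup>2"
    using AE_square_has_derivative[OF C]
  proof eventually_elim
    case (elim z)
    show ?case
    proof (cases "z \<in> {0<..<1} \<times> {0<..<1}")
      case True
      then have "(difference_quotient (\<lambda>t. ext C t (snd z)) (fst z) \<longlongrightarrow> square_d1 C z) (at 0)"
        using elim unfolding DERIV_def difference_quotient_def by blast
      moreover have "filterlim (\<lambda>n. 1 / real (Suc n)) (at 0) sequentially"
        using LIMSEQ_Suc[OF lim_1_over_n] by (intro filterlim_atI) auto
      ultimately have "(\<lambda>n. difference_quotient (\<lambda>t. ext C t (snd z)) (fst z) (1 / real (Suc n)))
          \<longlonglongrightarrow> square_d1 C z"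
        by (rule filterlim_compose)
      then show ?thesis using True by (simp only: indicator_simps mult_1 tendsto_power)
    qed (simp add: square_d1_def)
  qed
  show "AE z in lborel. norm ((indicator ({0<..<1} \<times> {0<..<1}) z *
     difference_quotient (\<lambda>t. ext C t (snd z)) (fst z) (1 / real (Suc n)))\<^sup>2)
       \<le> indicator (cbox (0,0) (1,1)) z" for n
    by (intro AE_I2 quotient_integrand_le_indicator C) simp
qed (use quotient_integrand_measurable[OF C] square_d1_measurable[OF C] integrable_unit_square_indicator
      in simp_all)

lemma quotient_energy_tendsto_pointwise:
  assumes Cn: "\<And>n. is_copula (Cn n)" and C: "is_copula C" and h: "h > 0"
    and lim: "\<And>u v. u \<in> {0..1} \<Longrightarrow> v \<in> {0..1} \<Longrightarrow> (\<lambda>n. Cn n u v) \<longlonglongrightarrow> C u v"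
  shows "(\<lambda>n. quotient_energy h (Cn n)) \<longlonglongrightarrow> quotient_energy h C"
  unfolding quotient_energy_def
proof (rule integral_dominated_convergence[where w = "indicator (cbox (0,0) (1,1))"])
  have "(\<lambda>n. ext (Cn n) u v) \<longlonglongrightarrow> ext C u v" for u v
    unfolding ext_def by (intro lim) auto
  then show "AE z in lborel. (\<lambda>n. (indicator ({0<..<1} \<times> {0<..<1}) z *
      difference_quotient (\<lambda>t. ext (Cn n) t (snd z)) (fst z) h)\<^sup>2)
      \<longlonglongrightarrow> (indicator ({0<..<1} \<times> {0<..<1}) z * difference_quotient (\<lambda>t. ext C t (snd z)) (fst z) h)\<^sup>2"
    using h unfolding difference_quotient_def by (intro AE_I2 tendsto_intros) auto
  show "AE z in lborel. norm ((indicator ({0<..<1} \<times> {0<..<1}) z *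
     difference_quotient (\<lambda>t. ext (Cn n) t (snd z)) (fst z) h)\<^sup>2)
       \<le> indicator (cbox (0,0) (1,1)) z" for n
    by (intro AE_I2 quotient_integrand_le_indicator Cn h)
qed (use quotient_integrand_measurable[OF C] quotient_integrand_measurable[OF Cn]
      integrable_unit_square_indicator in simp_all)

text \<open>For fixed \<open>h\<close>, the quotient energy of \<open>C\<close> is the limit of
  those of \<open>Cn n\<close>, each at most \<open>energy (Cn n)\<close>; so it is at most
  \<open>e\<close>. Letting \<open>h\<close> tend to 0 recovers \<open>energy C\<close>.\<close>

lemma energy_lower_semicontinuous:
  assumes Cn: "\<And>n. is_copula (Cn n)" and C: "is_copula C"
    and lim: "\<And>u v. u \<in> {0..1} \<Longrightarrow> v \<in> {0..1} \<Longrightarrow> (\<lambda>n. Cn n u v) \<longlonglongrightarrow> C u v"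
    and e: "(\<lambda>n. energy (Cn n)) \<longlonglongrightarrow> e"
  shows "energy C \<le> e"
proof (rule LIMSEQ_le_const2[OF quotient_energy_tendsto[OF C]])
  have "quotient_energy (1 / real (Suc k)) C \<le> e" for k
    by (rule LIMSEQ_le[OF quotient_energy_tendsto_pointwise[OF Cn C _ lim] e])
       (simp_all add: quotient_energy_le[OF Cn])
  then show "\<exists>N. \<forall>k\<ge>N. quotient_energy (1 / real (Suc k)) C \<le> e" by blast
qed

section \<open>Limits of copulas\<close>

lemma psi_tendsto:
  assumes Cn: "\<And>n. is_copula (Cn n)"
    and lim: "\<And>u v. u \<in> {0..1} \<Longrightarrow> v \<in> {0..1} \<Longrightarrow> (\<lambda>n. Cn n u v) \<longlonglongrightarrow> C u v"
  shows "(\<lambda>n. psi (Cn n)) \<longlonglongrightarrow> psi C"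
proof -
  have "(\<lambda>n. integral {0..1} (\<lambda>u. Cn n u u)) \<longlonglongrightarrow> integral {0..1} (\<lambda>u. C u u)"
  proof (rule dominated_convergence(2)[where h = "\<lambda>_. 1"])
    show "(\<lambda>u. Cn n u u) integrable_on {0..1}" for n
      using diagonal_has_integral[OF Cn] by blast
    show "norm (Cn n u u) \<le> 1" if "u \<in> {0..1}" for n u
      using diagonal_bounds[OF Cn, of u n] that by auto
  qed (use lim in auto)
  then show ?thesis unfolding psi_def by (intro tendsto_intros)
qed

text \<open>Copulas are bounded by 1 and share a Lipschitz constant, so Arzela-Ascoli applies; the
  defining conditions are equalities and weak inequalities between finitely many values and survive
  pointwise limits.\<close>

lemma copulas_sequentially_compact:
  assumes Cn: "\<And>n. is_copula (Cn n)"
  obtains C k where "is_copula C" "strict_mono (k :: nat \<Rightarrow> nat)"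
    "\<And>u v. u \<in> {0..1} \<Longrightarrow> v \<in> {0..1} \<Longrightarrow> (\<lambda>n. Cn (k n) u v) \<longlonglongrightarrow> C u v"
proof -
  let ?F = "\<lambda>n z. Cn n (fst z) (snd z)"
  let ?S = "{0..1} \<times> {0..1} :: (real \<times> real) set"
  have bd: "norm (?F n z) \<le> 1" if "z \<in> ?S" for n z
    using copula_increment_fst[OF Cn, of 0 "fst z" "snd z" n] copula_boundary[OF Cn, of "snd z" n] that
    by auto
  have eq: "\<exists>d. 0 < d \<and> (\<forall>n y. y \<in> ?S \<and> norm (x - y) < d \<longrightarrow> norm (?F n x - ?F n y) < e)"
    if x: "x \<in> ?S" and e: "0 < e" for x e
  proof (intro exI[of _ "e / 2"] conjI allI impI)
    fix n y assume y: "y \<in> ?S \<and> norm (x - y) < e / 2"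
    have "\<bar>fst x - fst y\<bar> \<le> norm (x - y)" "\<bar>snd x - snd y\<bar> \<le> norm (x - y)"
      using dist_fst_le[of x y] dist_snd_le[of x y] by (simp_all add: dist_norm)
    moreover have "\<bar>?F n x - ?F n y\<bar> \<le> \<bar>fst x - fst y\<bar> + \<bar>snd x - snd y\<bar>"
      using ext_diff_le[OF Cn, of n "fst x" "snd x" "fst y" "snd y"] x y by auto
    ultimately show "norm (?F n x - ?F n y) < e" using y by auto
  qed (use e in simp)
  have "compact ?S" by (intro compact_Times compact_Icc)
  from Arzela_Ascoli[OF this bd eq]
  obtain g k where k: "strict_mono (k :: nat \<Rightarrow> nat)"
    and g: "\<And>e. 0 < e \<Longrightarrow> \<exists>N. \<forall>n x. n \<ge> N \<and> x \<in> ?S \<longrightarrow> norm (?F (k n) x - g x) < e"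
    by metis
  define C where "C = (\<lambda>u v. g (u, v))"
  have lim: "(\<lambda>n. Cn (k n) u v) \<longlonglongrightarrow> C u v" if "u \<in> {0..1}" "v \<in> {0..1}" for u v
  proof (rule LIMSEQ_I)
    fix e :: real assume "0 < e"
    from g[OF this] obtain N where "\<forall>n x. n \<ge> N \<and> x \<in> ?S \<longrightarrow> norm (?F (k n) x - g x) < e" by blast
    then show "\<exists>N. \<forall>n\<ge>N. norm (Cn (k n) u v - C u v) < e"
      using that unfolding C_def by (intro exI[of _ N]) auto
  qed
  have "is_copula C"
    unfolding is_copula_def
  proof (intro conjI ballI allI impI)
    fix u :: real assume u: "u \<in> {0..1}"
    show "C u 0 = 0"
      by (rule LIMSEQ_unique[OF lim[of u 0]]) (use u in \<open>auto simp: copula_boundary[OF Cn]\<close>)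
    show "C 0 u = 0"
      by (rule LIMSEQ_unique[OF lim[of 0 u]]) (use u in \<open>auto simp: copula_boundary[OF Cn]\<close>)
    show "C u 1 = u"
      by (rule LIMSEQ_unique[OF lim[of u 1]]) (use u in \<open>auto simp: copula_boundary[OF Cn]\<close>)
    show "C 1 u = u"
      by (rule LIMSEQ_unique[OF lim[of 1 u]]) (use u in \<open>auto simp: copula_boundary[OF Cn]\<close>)
  next
    fix u1 u2 v1 v2 :: real
    assume *: "0 \<le> u1 \<and> u1 \<le> u2 \<and> u2 \<le> 1 \<and> 0 \<le> v1 \<and> v1 \<le> v2 \<and> v2 \<le> 1"
    have "(\<lambda>n. Cn (k n) u2 v2 - Cn (k n) u2 v1 - Cn (k n) u1 v2 + Cn (k n) u1 v1)
        \<longlonglongrightarrow> C u2 v2 - C u2 v1 - C u1 v2 + C u1 v1"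
      using * by (intro tendsto_intros lim) auto
    moreover have "Cn (k n) u2 v2 - Cn (k n) u2 v1 - Cn (k n) u1 v2 + Cn (k n) u1 v1 \<ge> 0" for n
      using copula_2increasing[OF Cn] * by blast
    ultimately show "C u2 v2 - C u2 v1 - C u1 v2 + C u1 v1 \<ge> 0"
      by (intro LIMSEQ_le_const) auto
  qed
  then show ?thesis using k lim by (rule that)
qed

text \<open>A subsequence of the copulas converges to some \<open>C\<close> with
  \<open>psi C = snd l\<close>, but semicontinuity gives only \<open>xi C \<le> fst l\<close>. As
  \<open>fst l \<le> 1\<close>, moving right inside the region reaches \<open>l\<close>.\<close>

lemma closed_region: "closed region"
  unfolding closed_sequential_limits
proof (intro allI impI)
  fix p :: "nat \<Rightarrow> real \<times> real" and l
  assume p: "(\<forall>n. p n \<in> region) \<and> p \<longlonglongrightarrow> l"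
  then have "\<forall>n. \<exists>C. is_copula C \<and> p n = (xi C, psi C)" by (auto simp: region_def)
  then obtain Cn where Cn: "\<And>n. is_copula (Cn n)" "\<And>n. p n = (xi (Cn n), psi (Cn n))" by metis
  obtain C k where C: "is_copula C" and k: "strict_mono (k :: nat \<Rightarrow> nat)"
    and lim: "\<And>u v. u \<in> {0..1} \<Longrightarrow> v \<in> {0..1} \<Longrightarrow> (\<lambda>n. Cn (k n) u v) \<longlonglongrightarrow> C u v"
    using copulas_sequentially_compact[of Cn] Cn(1) by metis
  have pk: "(\<lambda>n. p (k n)) \<longlonglongrightarrow> l"
    using LIMSEQ_subseq_LIMSEQ[OF conjunct2[OF p] k] by (simp add: o_def)
  have x: "(\<lambda>n. xi (Cn (k n))) \<longlonglongrightarrow> fst l" and y: "(\<lambda>n. psi (Cn (k n))) \<longlonglongrightarrow> snd l"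
    using tendsto_fst[OF pk] tendsto_snd[OF pk] by (simp_all add: Cn(2))
  have "snd l = psi C"
    using y psi_tendsto[of "\<lambda>n. Cn (k n)", OF Cn(1) lim] LIMSEQ_unique by blast
  have "(\<lambda>n. (xi (Cn (k n)) + 2) / 6) \<longlonglongrightarrow> (fst l + 2) / 6"
    by (intro tendsto_intros x) simp
  then have "(\<lambda>n. energy (Cn (k n))) \<longlonglongrightarrow> (fst l + 2) / 6"
    by (simp add: xi_eq_energy[OF Cn(1)])
  from energy_lower_semicontinuous[of "\<lambda>n. Cn (k n)", OF Cn(1) C lim this]
  have "xi C \<le> fst l" by (simp add: xi_eq_energy[OF C])
  moreover have "fst l \<le> 1"
    by (rule LIMSEQ_le_const2[OF x]) (use xi_le_1[OF Cn(1)] in auto)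
  ultimately have "(fst l, psi C) \<in> region" by (rule region_right_closed[OF C])
  then show "l \<in> region" using \<open>snd l = psi C\<close> by (metis prod.collapse)
qed

theorem mainTheorem7:
  shows "region \<subseteq> {0..1} \<times> {-1/2..1}
    \<and> convex region \<and> closed region
    \<and> (\<forall>(x, y) \<in> region. y \<le> sqrt x)
    \<and> (\<forall>(x, y) \<in> region. y \<le> 0 \<longrightarrow>
         (\<exists>!m. m \<in> {0..2} \<and> mu_cubic y m = 0) \<and> x \<ge> Xi (mu y))"
proof (intro conjI convex_region closed_region)
  have "0 \<le> xi C" if "is_copula C" for C
    using psi_power2_le_xi[OF that] zero_le_power2[of "psi C"] by linarith
  then show "region \<subseteq> {0..1} \<times> {-1/2..1}"
    using xi_le_1 psi_bounds by (auto simp: region_def)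
  show "\<forall>(x, y) \<in> region. y \<le> sqrt x"
    using psi_power2_le_xi by (auto simp: region_def intro: real_le_rsqrt)
  show "\<forall>(x, y) \<in> region. y \<le> 0 \<longrightarrow>
         (\<exists>!m. m \<in> {0..2} \<and> mu_cubic y m = 0) \<and> x \<ge> Xi (mu y)"
  proof clarify
    fix x y assume "(x, y) \<in> region" and y: "y \<le> 0"
    then obtain C where C: "is_copula C" "x = xi C" "y = psi C" by (auto simp: region_def)
    then show "(\<exists>!m. m \<in> {0..2} \<and> mu_cubic y m = 0) \<and> Xi (mu y) \<le> x"
      using mu_cubic_unique_root[of y] psi_bounds(1)[OF C(1)] xi_ge_Xi[OF C(1)] y by simp
  qed
qed

end
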